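(* Let $\mathcal{G}_0=(B_0,\psi_0,A_0)$ and $\mathcal{G}_1=(B_1,\psi_1,A_1)$ be quantum graphs with $\delta_i$-forms $\psi_i$ and quantum relations $\mathcal{S}_i=\mathrm{range}(A_i\bullet\cdot)\subset B(L^2(\mathcal{G}_i))$. Let $t\in\{loc,q,qa,qc,C^*,alg\}$, let $\mathcal{A}$ be a unital $*$-algebra of the class associated with $t$, and let $f:B_1\to B_0\otimes\mathcal{A}$ be a unital $*$-homomorphism. The following are equivalent: (1) $f^\dagger(\mathcal{S}_0\otimes 1_{\mathcal{A}})f\subset\mathcal{S}_1\otimes\mathcal{A}$; (2) $A_1\bullet\bigl(f^\dagger((A_0\bullet T)\otimes 1_{\mathcal{A}})f\bigr)=f^\dagger((A_0\bullet T)\otimes 1_{\mathcal{A}})f$ for every $T\in B(L^2(\mathcal{G}_0))$; (3) $\langle S\,|\,f^\dagger(T\otimes 1_{\mathcal{A}})f\rangle=0$ in $\mathcal{A}$ for every $S\in\mathcal{S}_1^\perp$ and $T\in\mathcal{S}_0$; (4) $(R_{A_0}\otimes\mathrm{id}_{\mathcal{A}})\circ F\circ R_{A_1}=\delta_1^2\,(R_{A_0}\otimes\mathrm{id}_{\mathcal{A}})\circ F$ as linear maps $B_1\otimes B_1\to B_0\otimes B_0\otimes\mathcal{A}$, where $R_{A_i}:B_i\otimes B_i\to B_i\otimes B_i$ and $F:B_1\otimes B_1\to B_0\otimes B_0\otimes\mathcal{A}$ are the maps \[ R_{A_i}=(m_i\otimes\mathrm{id})(\mathrm{id}\otimes A_i\otimes\mathrm{id})(\mathrm{id}\otimes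 m_i^\dagger),\qquad F(x\otimes y)=f(x)_{13}\,f(y)_{23}. \]
   Context: A quantum set is a pair $(B,\psi)$ where $B$ is a finite-dimensional $C^*$-algebra with multiplication $m:B\otimes B\to B$, and $\psi$ is a faithful state on $B$ that is a $\delta$-form, i.e. $mm^\dagger=\delta^2\,\mathrm{id}_B$ for some $\delta\ge 0$. Here $B$ is regarded as the Hilbert space $L^2(B,\psi)$ with inner product $\langle x|y\rangle=\psi(x^*y)$, $B\otimes B$ carries the inner product from $\psi\otimes\psi$, and $(\cdot)^\dagger$ is the Hilbert space adjoint of operators. For linear maps $S,T:B\to B$, the Schur product is $S\bullet T=\delta^{-2}m(S\otimes T)m^\dagger$ and the involution is $T^*(x)=(T(x^* ))^*$. A quantum graph is a triple $\mathcal{G}=(B,\psi,A)$ with $(B,\psi)$ a quantum set and $A:B\to B$ linear satisfying $A\bullet A=A$; $L^2(\mathcal{G})=L^2(B,\psi)$. Its quantum relation is $\mathcal{S}=\mathrm{range}(A\bullet\cdot)=\{A\bullet T:T\in B(L^2(\mathcal{G}))\}$. $m_i$ is the multiplication of $B_i$. $B(L^2(\mathcal{G}))$ carries the inner product $\langle S|T\rangle=\langle\iota(S)|\iota(T)\rangle_{\psi\otimes\psi}=\delta^2\langle 1_B|(S^*\bullet T)1_B\rangle_\psi$, where $\iota(T)=(\mathrm{id}_B\otimes T)m^\dagger(1_B)\in B\otimes B$; $\mathcal{S}^\perp$ is the orthogonal complement for it. Classes of $\mathcal{A}$: $\mathcal{A}=\mathbb{C}$ if $t=loc$; $\mathcal{A}$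 is finite-dimensional if $t=q$; $\mathcal{A}=\mathcal{R}^\omega$, the ultrapower of the hyperfinite $II_1$-factor by a free ultrafilter $\omega$ on $\mathbb{N}$, if $t=qa$; $\mathcal{A}$ is a tracial $C^*$-algebra if $t=qc$; a $C^*$-algebra if $t=C^*$; an arbitrary unital $*$-algebra if $t=alg$ (tensor products with $\mathcal{A}$ are algebraic, the other factor being finite-dimensional). $f$ is viewed as an element of $B(L^2(\mathcal{G}_1),L^2(\mathcal{G}_0))\otimes\mathcal{A}$, and $f^\dagger\in B(L^2(\mathcal{G}_0),L^2(\mathcal{G}_1))\otimes\mathcal{A}$ is its image under $(\cdot)^\dagger\otimes(\cdot)^*$; products combine composition of operators with multiplication in $\mathcal{A}$. $A_1\bullet\cdot$ acts on the first tensor factor of $B(L^2(\mathcal{G}_1))\otimes\mathcal{A}$, and $\langle S|\cdot\rangle:B(L^2(\mathcal{G}_1))\otimes\mathcal{A}\to\mathcal{A}$ likewise acts on the first tensor factor. In (4), leg notation is used: if $f(x)=\sum_i x_i\otimes a_i$ and $f(y)=\sum_j y_j\otimes b_j$ then $f(x)_{13}f(y)_{23}=\sum_{i,j}x_i\otimes y_j\otimes a_ib_j$. *)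

theory Defs
  imports Complex_Main "HOL-Library.Multiset" "HOL-Library.Nonpos_Ints"
begin

section \<open>Complex vector spaces and unital *-algebras\<close>

class complex_vector = ab_group_add +
  fixes scaleC :: "complex \<Rightarrow> 'a \<Rightarrow> 'a" (infixr \<open>*\<^sub>C\<close> 75)
  assumes scaleC_add_right: "c *\<^sub>C (x + y) = c *\<^sub>C x + c *\<^sub>C y"
    and scaleC_add_left: "(c + d) *\<^sub>C x = c *\<^sub>C x + d *\<^sub>C x"
    and scaleC_scaleC: "c *\<^sub>C (d *\<^sub>C x) = (c * d) *\<^sub>C x"
    and scaleC_one: "1 *\<^sub>C x = x"

global_interpretation complex_vector: vector_space "scaleC :: complex \<Rightarrow> 'a \<Rightarrow> 'a::complex_vector"
  by unfold_locales (auto simp: scaleC_add_right scaleC_add_left scaleC_scaleC scaleC_one)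

abbreviation clinear :: "('a::complex_vector \<Rightarrow> 'b::complex_vector) \<Rightarrow> bool" where
  "clinear \<equiv> Vector_Spaces.linear scaleC scaleC"

lemma clinearI:
  assumes "\<And>x y. f (x + y) = f x + f y" "\<And>c x. f (c *\<^sub>C x) = c *\<^sub>C f x"
  shows "clinear f"
  by unfold_locales (use assms in auto)

lemma clinear_add: "clinear f \<Longrightarrow> f (x + y) = f x + f y"
  and clinear_scaleC: "clinear f \<Longrightarrow> f (c *\<^sub>C x) = c *\<^sub>C f x"
  by (auto simp: Vector_Spaces.linear.axioms module_hom.add module_hom.scale
      Vector_Spaces.linear_iff_module_hom)

definition finite_dim :: "'a::complex_vector set \<Rightarrow> bool" where
  "finite_dim V \<longleftrightarrow> (\<exists>S. finite S \<and> V \<subseteq> complex_vector.span S)"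

text \<open>The zero algebra is a member of this class: \<open>0 \<noteq> 1\<close> is not required.\<close>

class complex_star_algebra = complex_vector + ring + monoid_mult +
  fixes star :: "'a \<Rightarrow> 'a"
  assumes mult_scaleC_left: "(c *\<^sub>C x) * y = c *\<^sub>C (x * y)"
    and mult_scaleC_right: "x * (c *\<^sub>C y) = c *\<^sub>C (x * y)"
    and star_add: "star (x + y) = star x + star y"
    and star_scaleC: "star (c *\<^sub>C x) = cnj c *\<^sub>C star x"
    and star_mult: "star (x * y) = star y * star x"
    and star_star: "star (star x) = x"

instantiation complex :: complex_star_algebra
begin
definition scaleC_complex :: "complex \<Rightarrow> complex \<Rightarrow> complex" where "scaleC_complex = (*)"
definition star_complex :: "complex \<Rightarrow> complex" where "star_complex = cnj"
instance
  by standard (auto simp: scaleC_complex_def star_complex_def algebra_simps)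
end


section \<open>The vector space of linear maps\<close>

typedef (overloaded) ('x, 'y) lmap =
  "{f :: 'x::complex_vector \<Rightarrow> 'y::complex_vector. clinear f}"
  morphisms lapp Abs_lmap
  by (rule exI[of _ "\<lambda>_. 0"]) (auto intro: clinearI)

notation lapp (infixr \<open>\<cdot>\<close> 110)

setup_lifting type_definition_lmap

lemma lapp_clinear: "clinear (lapp T)"
  using lapp by auto

lemma lapp_add: "T \<cdot> (x + y) = T \<cdot> x + T \<cdot> y"
  and lapp_scaleC: "T \<cdot> (c *\<^sub>C x) = c *\<^sub>C T \<cdot> x"
  by (rule clinear_add[OF lapp_clinear] clinear_scaleC[OF lapp_clinear])+

lemma lmap_eqI: "(\<And>x. S \<cdot> x = T \<cdot> x) \<Longrightarrow> S = T"
  by transfer auto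

instantiation lmap :: (complex_vector, complex_vector) complex_vector
begin
lift_definition zero_lmap :: "('a, 'b) lmap" is "\<lambda>_. 0"
  by (auto intro: clinearI)
lift_definition plus_lmap :: "('a, 'b) lmap \<Rightarrow> ('a, 'b) lmap \<Rightarrow> ('a, 'b) lmap" is "\<lambda>S T x. S x + T x"
  by (rule clinearI) (auto simp: clinear_add clinear_scaleC scaleC_add_right)
lift_definition uminus_lmap :: "('a, 'b) lmap \<Rightarrow> ('a, 'b) lmap" is "\<lambda>T x. - T x"
  by (rule clinearI) (auto simp: clinear_add clinear_scaleC)
lift_definition minus_lmap :: "('a, 'b) lmap \<Rightarrow> ('a, 'b) lmap \<Rightarrow> ('a, 'b) lmap" is "\<lambda>S T x. S x - T x"
  by (rule clinearI) (auto simp: clinear_add clinear_scaleC complex_vector.scale_right_diff_distrib)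
lift_definition scaleC_lmap :: "complex \<Rightarrow> ('a, 'b) lmap \<Rightarrow> ('a, 'b) lmap" is "\<lambda>c T x. c *\<^sub>C T x"
  by (rule clinearI) (auto simp: clinear_add clinear_scaleC scaleC_add_right scaleC_scaleC mult.commute)
instance
  by standard (transfer; force simp: scaleC_add_right scaleC_add_left scaleC_scaleC scaleC_one)+
end

lift_definition lid :: "('x::complex_vector, 'x) lmap" is "\<lambda>x. x"
  by (auto intro: clinearI)

lift_definition lcomp :: "('y::complex_vector, 'z::complex_vector) lmap \<Rightarrow>
    ('x::complex_vector, 'y) lmap \<Rightarrow> ('x, 'z) lmap" (infixl \<open>\<circ>\<^sub>L\<close> 67)
  is "\<lambda>S T x. S (T x)"
  by (rule clinearI) (auto simp: clinear_add clinear_scaleC)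

lemma lapp_simps [simp]:
  "(S + T) \<cdot> x = S \<cdot> x + T \<cdot> x" "(c *\<^sub>C T) \<cdot> x = c *\<^sub>C T \<cdot> x"
  "(S' \<circ>\<^sub>L T) \<cdot> x = S' \<cdot> T \<cdot> x" "lid \<cdot> x = x" "0 \<cdot> x = 0"
  by (transfer, simp)+

lemma lcomp_bilinear:
  "(S + S') \<circ>\<^sub>L T = S \<circ>\<^sub>L T + S' \<circ>\<^sub>L T" "S \<circ>\<^sub>L (T + T') = S \<circ>\<^sub>L T + S \<circ>\<^sub>L T'"
  "(c *\<^sub>C S) \<circ>\<^sub>L T = c *\<^sub>C (S \<circ>\<^sub>L T)" "S \<circ>\<^sub>L (c *\<^sub>C T) = c *\<^sub>C (S \<circ>\<^sub>L T)"
  by (rule lmap_eqI; simp add: lapp_add lapp_scaleC)+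


section \<open>The algebraic tensor product\<close>

text \<open>Multisets of pairs are the formal finite sums of elementary tensors; \<open>tensor_eq\<close> is the
  congruence generated by bilinearity. Additive inverses arise as \<open>(-1) *\<^sub>C t\<close>.\<close>

inductive tensor_eq ::
  "('x::complex_vector \<times> 'y::complex_vector) multiset \<Rightarrow> ('x \<times> 'y) multiset \<Rightarrow> bool" where
  refl: "tensor_eq M M"
| sym: "tensor_eq M N \<Longrightarrow> tensor_eq N M"
| trans: "tensor_eq L M \<Longrightarrow> tensor_eq M N \<Longrightarrow> tensor_eq L N"
| cong: "tensor_eq M N \<Longrightarrow> tensor_eq (M + L) (N + L)"
| zero: "tensor_eq {#(0, y)#} {#}"
| add_left: "tensor_eq {#(x + x', y)#} {#(x, y), (x', y)#}"
| add_right: "tensor_eq {#(x, y + y')#} {#(x, y), (x, y')#}"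
| scale: "tensor_eq {#(c *\<^sub>C x, y)#} {#(x, c *\<^sub>C y)#}"

lemma tensor_eq_cong2:
  assumes "tensor_eq M M'" "tensor_eq N N'"
  shows "tensor_eq (M + N) (M' + N')"
  using tensor_eq.cong[OF assms(1), of N] tensor_eq.cong[OF assms(2), of M']
  by (metis add.commute tensor_eq.trans)

quotient_type (overloaded) ('x, 'y) tensor =
  "('x::complex_vector \<times> 'y::complex_vector) multiset" / tensor_eq
  by (rule equivpI) (auto intro!: reflpI sympI transpI intro: tensor_eq.refl tensor_eq.sym tensor_eq.trans)

lemma tensor_eq_scaleC:
  "tensor_eq M N \<Longrightarrow>
    tensor_eq (image_mset (map_prod ((*\<^sub>C) c) id) M) (image_mset (map_prod ((*\<^sub>C) c) id) N)"
proof (induction rule: tensor_eq.induct)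
  case (scale d x y)
  show ?case using tensor_eq.scale[of d "c *\<^sub>C x" y] by (simp add: scaleC_scaleC mult.commute)
qed (auto simp: scaleC_add_right intro: tensor_eq.intros)

lemma tensor_eq_scaleC_add:
  "tensor_eq (image_mset (map_prod ((*\<^sub>C) (c + d)) id) M)
    (image_mset (map_prod ((*\<^sub>C) c) id) M + image_mset (map_prod ((*\<^sub>C) d) id) M)"
proof (induction M)
  case (add p M)
  obtain x y where p: "p = (x, y)" by (cases p)
  have "tensor_eq {#((c + d) *\<^sub>C x, y)#} {#(c *\<^sub>C x, y), (d *\<^sub>C x, y)#}"
    by (simp add: scaleC_add_left tensor_eq.add_left)
  from tensor_eq_cong2[OF this add] show ?case by (simp add: p add_mset_commute)
qed (auto intro: tensor_eq.refl)

lemma tensor_eq_scaleC_zero: "tensor_eq (image_mset (map_prod ((*\<^sub>C) 0) id) M) {#}"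
proof (induction M)
  case (add p M)
  obtain x y where p: "p = (x, y)" by (cases p)
  from tensor_eq_cong2[OF tensor_eq.zero[of y] add] show ?case by (simp add: p)
qed (auto intro: tensor_eq.refl)

instantiation tensor :: (complex_vector, complex_vector) complex_vector
begin
lift_definition zero_tensor :: "('a, 'b) tensor" is "{#}" .
lift_definition plus_tensor :: "('a, 'b) tensor \<Rightarrow> ('a, 'b) tensor \<Rightarrow> ('a, 'b) tensor" is "(+)"
  by (rule tensor_eq_cong2)
lift_definition scaleC_tensor :: "complex \<Rightarrow> ('a, 'b) tensor \<Rightarrow> ('a, 'b) tensor"
  is "\<lambda>c. image_mset (map_prod ((*\<^sub>C) c) id)"
  by (rule tensor_eq_scaleC)
definition uminus_tensor :: "('a, 'b) tensor \<Rightarrow> ('a, 'b) tensor" where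
  "uminus_tensor t = (-1) *\<^sub>C t"
definition minus_tensor :: "('a, 'b) tensor \<Rightarrow> ('a, 'b) tensor \<Rightarrow> ('a, 'b) tensor" where
  "minus_tensor t u = t + - u"
instance
proof
  fix t u v :: "('a, 'b) tensor" and c d :: complex
  have zero: "0 *\<^sub>C t = 0" by transfer (rule tensor_eq_scaleC_zero)
  show one: "1 *\<^sub>C t = t"
    by transfer (simp add: scaleC_one[abs_def] map_prod.id[unfolded id_def] id_def tensor_eq.refl)
  show dist: "(c + d) *\<^sub>C t = c *\<^sub>C t + d *\<^sub>C t" for c d :: complex
    by transfer (rule tensor_eq_scaleC_add)
  show "t + u + v = t + (u + v)" "t + u = u + t" "0 + t = t"
    by (transfer, simp add: ac_simps tensor_eq.refl)+
  show "t - u = t + - u" by (simp add: minus_tensor_def)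
  show "- t + t = 0" using dist[of "-1" 1] by (simp add: uminus_tensor_def zero one)
  show "c *\<^sub>C (t + u) = c *\<^sub>C t + c *\<^sub>C u" by transfer (simp add: tensor_eq.refl)
  show "c *\<^sub>C d *\<^sub>C t = (c * d) *\<^sub>C t"
    by transfer (simp add: multiset.map_comp comp_def map_prod_def scaleC_scaleC tensor_eq.refl
        split_def)
qed
end

lift_definition elem_tensor :: "'x::complex_vector \<Rightarrow> 'y::complex_vector \<Rightarrow> ('x, 'y) tensor"
  (infixr \<open>\<otimes>\<close> 70) is "\<lambda>x y. {#(x, y)#}" .

lemma tensor_add_left: "(x + x') \<otimes> y = x \<otimes> y + x' \<otimes> y"
  by transfer (simp add: tensor_eq.add_left add_mset_commute)

lemma tensor_add_right: "x \<otimes> (y + y') = x \<otimes> y + x \<otimes> y'"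
  by transfer (simp add: tensor_eq.add_right add_mset_commute)

lemma tensor_scaleC_left: "(c *\<^sub>C x) \<otimes> y = c *\<^sub>C (x \<otimes> y)"
  by transfer (simp add: tensor_eq.refl)

lemma tensor_scaleC_right: "x \<otimes> (c *\<^sub>C y) = c *\<^sub>C (x \<otimes> y)"
  by transfer (simp add: tensor_eq.sym[OF tensor_eq.scale])

lemma tensor_induct [case_names zero elem add, induct type: tensor]:
  assumes "P 0" "\<And>x y. P (x \<otimes> y)" "\<And>t u. P t \<Longrightarrow> P u \<Longrightarrow> P (t + u)"
  shows "P t"
proof -
  have "P (abs_tensor M)" for M
  proof (induction M)
    case empty
    then show ?case using assms(1) by (simp add: zero_tensor_def)
  next
    case (add p M)
    have "abs_tensor (add_mset p M) = fst p \<otimes> snd p + abs_tensor M"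
      by (simp add: elem_tensor.abs_eq plus_tensor.abs_eq)
    then show ?case using assms add by simp
  qed
  then show ?thesis by (metis Quotient3_tensor Quotient3_abs_rep)
qed

text \<open>The universal property. It is stated for balanced biadditive maps, so that it covers both
  bilinear maps and maps that are conjugate-linear in both arguments (adjoints, involutions).
  For other maps the value of \<open>tensor_lift\<close> is meaningless.\<close>

definition balanced :: "('x::complex_vector \<Rightarrow> 'y::complex_vector \<Rightarrow> 'z::ab_group_add) \<Rightarrow> bool" where
  "balanced \<beta> \<longleftrightarrow> (\<forall>x x' y. \<beta> (x + x') y = \<beta> x y + \<beta> x' y) \<and>
    (\<forall>x y y'. \<beta> x (y + y') = \<beta> x y + \<beta> x y') \<and> (\<forall>c x y. \<beta> (c *\<^sub>C x) y = \<beta> x (c *\<^sub>C y))"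

definition tensor_lift ::
  "('x::complex_vector \<Rightarrow> 'y::complex_vector \<Rightarrow> 'z::ab_group_add) \<Rightarrow> ('x, 'y) tensor \<Rightarrow> 'z" where
  "tensor_lift \<beta> t = (\<Sum>(x, y) \<in># rep_tensor t. \<beta> x y)"

lemma tensor_lift_abs:
  assumes "balanced \<beta>"
  shows "tensor_lift \<beta> (abs_tensor M) = (\<Sum>(x, y) \<in># M. \<beta> x y)"
proof -
  have zero: "\<beta> 0 y = 0" for y
    using assms unfolding balanced_def by (metis add_cancel_right_left add.right_neutral)
  have "(\<Sum>(x, y) \<in># M. \<beta> x y) = (\<Sum>(x, y) \<in># N. \<beta> x y)" if "tensor_eq M N" for M N
    using that by induction (use assms zero in \<open>auto simp: balanced_def\<close>)
  moreover have "tensor_eq (rep_tensor (abs_tensor M)) M"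
    by (metis Quotient3_abs_rep Quotient3_rel_rep Quotient3_tensor tensor.abs_eq_iff)
  ultimately show ?thesis by (simp add: tensor_lift_def)
qed

lemma tensor_lift_elem: "balanced \<beta> \<Longrightarrow> tensor_lift \<beta> (x \<otimes> y) = \<beta> x y"
  by (simp add: elem_tensor.abs_eq tensor_lift_abs)

lemma tensor_lift_zero: "balanced \<beta> \<Longrightarrow> tensor_lift \<beta> 0 = 0"
  by (simp add: zero_tensor_def tensor_lift_abs)

lemma tensor_lift_add:
  assumes "balanced \<beta>"
  shows "tensor_lift \<beta> (t + u) = tensor_lift \<beta> t + tensor_lift \<beta> u"
proof -
  have "t = abs_tensor (rep_tensor t)" "u = abs_tensor (rep_tensor u)"
    by (metis Quotient3_tensor Quotient3_abs_rep)+
  then have "t + u = abs_tensor (rep_tensor t + rep_tensor u)" by (metis plus_tensor.abs_eq)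
  then show ?thesis by (simp add: tensor_lift_abs[OF assms]) (simp add: tensor_lift_def)
qed

lemma tensor_lift_scaleC:
  fixes \<beta> :: "'x::complex_vector \<Rightarrow> 'y::complex_vector \<Rightarrow> 'z::complex_vector"
  assumes "balanced \<beta>" "\<And>c x y. \<beta> (c *\<^sub>C x) y = c *\<^sub>C \<beta> x y"
  shows "tensor_lift \<beta> (c *\<^sub>C t) = c *\<^sub>C tensor_lift \<beta> t"
  by (induction t) (use assms in \<open>simp_all add: tensor_lift_zero tensor_lift_elem
      tensor_lift_add scaleC_add_right flip: tensor_scaleC_left\<close>)

lemma tensor_lift_clinear:
  fixes \<beta> :: "'x::complex_vector \<Rightarrow> 'y::complex_vector \<Rightarrow> 'z::complex_vector"
  assumes "\<And>x x' y. \<beta> (x + x') y = \<beta> x y + \<beta> x' y" "\<And>x y y'. \<beta> x (y + y') = \<beta> x y + \<beta> x y'"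
    and "\<And>c x y. \<beta> (c *\<^sub>C x) y = c *\<^sub>C \<beta> x y" "\<And>c x y. \<beta> x (c *\<^sub>C y) = c *\<^sub>C \<beta> x y"
  shows "balanced \<beta>" "clinear (tensor_lift \<beta>)"
proof -
  show "balanced \<beta>" using assms by (simp add: balanced_def)
  then show "clinear (tensor_lift \<beta>)"
    by (intro clinearI) (simp_all add: tensor_lift_add tensor_lift_scaleC assms)
qed

text \<open>\<open>g \<otimes> h\<close> for \<open>g\<close>, \<open>h\<close> both linear or both conjugate-linear.\<close>

definition tensor_map :: "('x::complex_vector \<Rightarrow> 'u::complex_vector) \<Rightarrow>
    ('y::complex_vector \<Rightarrow> 'v::complex_vector) \<Rightarrow> ('x, 'y) tensor \<Rightarrow> ('u, 'v) tensor" where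
  "tensor_map g h = tensor_lift (\<lambda>x y. g x \<otimes> h y)"

lift_definition ltensor :: "('x::complex_vector, 'u::complex_vector) lmap \<Rightarrow>
    ('y::complex_vector, 'v::complex_vector) lmap \<Rightarrow> (('x, 'y) tensor, ('u, 'v) tensor) lmap"
    (infixr \<open>\<otimes>\<^sub>L\<close> 70)
  is tensor_map
  unfolding tensor_map_def
  by (rule tensor_lift_clinear(2))
    (simp_all add: clinear_add clinear_scaleC tensor_add_left tensor_add_right tensor_scaleC_left
      tensor_scaleC_right)

text \<open>Multiplication of tensors over an algebra in the second leg,
  \<open>(x \<otimes> a, y \<otimes> b) \<mapsto> \<beta> x y \<otimes> a b\<close>. It is used for the product of \<open>X \<otimes> \<A>\<close>, for composition of
  \<open>\<A>\<close>-valued operators, and (with \<open>\<beta>\<close> the elementary tensor) for the leg product \<open>t\<^sub>1\<^sub>3 u\<^sub>2\<^sub>3\<close>.\<close>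

definition tensor_times :: "('x::complex_vector \<Rightarrow> 'y::complex_vector \<Rightarrow> 'z::complex_vector) \<Rightarrow>
    ('x, 'a::complex_star_algebra) tensor \<Rightarrow> ('y, 'a) tensor \<Rightarrow> ('z, 'a) tensor" where
  "tensor_times \<beta> t u = tensor_lift (\<lambda>x a. tensor_lift (\<lambda>y b. \<beta> x y \<otimes> (a * b)) u) t"

locale cbilinear =
  fixes \<beta> :: "'x::complex_vector \<Rightarrow> 'y::complex_vector \<Rightarrow> 'z::complex_vector"
  assumes add_l: "\<beta> (x + x') y = \<beta> x y + \<beta> x' y" and add_r: "\<beta> x (y + y') = \<beta> x y + \<beta> x y'"
    and scale_l: "\<beta> (c *\<^sub>C x) y = c *\<^sub>C \<beta> x y" and scale_r: "\<beta> x (c *\<^sub>C y) = c *\<^sub>C \<beta> x y"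
begin

lemma inner_bilinear:
  fixes a :: "'a::complex_star_algebra"
  shows "balanced (\<lambda>y b. \<beta> x y \<otimes> (a * b))" "clinear (tensor_lift (\<lambda>y b. \<beta> x y \<otimes> (a * b)))"
  by (rule tensor_lift_clinear; simp add: add_r scale_r tensor_add_left tensor_add_right
      tensor_scaleC_left tensor_scaleC_right distrib_left mult_scaleC_right)+

lemma outer_bilinear:
  fixes u :: "('y, 'a::complex_star_algebra) tensor"
  defines "\<gamma> \<equiv> \<lambda>x a. tensor_lift (\<lambda>y b. \<beta> x y \<otimes> (a * b)) u"
  shows "balanced \<gamma>" "clinear (tensor_lift \<gamma>)"
proof -
  have 1: "\<gamma> (x + x') a = \<gamma> x a + \<gamma> x' a" for x x' a unfolding \<gamma>_def
    by (induction u, simp_all only: tensor_lift_zero[OF inner_bilinear(1)] tensor_lift_elem[OF inner_bilinear(1)]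
        tensor_lift_add[OF inner_bilinear(1)]) (simp_all add: add_l tensor_add_left ac_simps)
  have 2: "\<gamma> x (a + a') = \<gamma> x a + \<gamma> x a'" for x a a' unfolding \<gamma>_def
    by (induction u, simp_all only: tensor_lift_zero[OF inner_bilinear(1)] tensor_lift_elem[OF inner_bilinear(1)]
        tensor_lift_add[OF inner_bilinear(1)]) (simp_all add: distrib_right tensor_add_right ac_simps)
  have 3: "\<gamma> (c *\<^sub>C x) a = c *\<^sub>C \<gamma> x a" for c x a unfolding \<gamma>_def
    by (induction u, simp_all only: tensor_lift_zero[OF inner_bilinear(1)] tensor_lift_elem[OF inner_bilinear(1)]
        tensor_lift_add[OF inner_bilinear(1)]) (simp_all add: scale_l tensor_scaleC_left scaleC_add_right ac_simps)
  have 4: "\<gamma> x (c *\<^sub>C a) = c *\<^sub>C \<gamma> x a" for c x a unfolding \<gamma>_def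
    by (induction u, simp_all only: tensor_lift_zero[OF inner_bilinear(1)] tensor_lift_elem[OF inner_bilinear(1)]
        tensor_lift_add[OF inner_bilinear(1)]) (simp_all add: mult_scaleC_left tensor_scaleC_right scaleC_add_right ac_simps)
  show "balanced \<gamma>" "clinear (tensor_lift \<gamma>)"
    by (rule tensor_lift_clinear; simp add: 1 2 3 4)+
qed

lemma times_elem: "tensor_times \<beta> (x \<otimes> a) (y \<otimes> b) = \<beta> x y \<otimes> (a * b)"
  using tensor_lift_elem[OF outer_bilinear(1)[of "y \<otimes> b"], of x a]
  by (simp only: tensor_times_def tensor_lift_elem[OF inner_bilinear(1)])

lemma times_add_left: "tensor_times \<beta> (t + t') u = tensor_times \<beta> t u + tensor_times \<beta> t' u"
  by (simp add: tensor_times_def tensor_lift_add outer_bilinear)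

lemma times_scale_left: "tensor_times \<beta> (c *\<^sub>C t) u = c *\<^sub>C tensor_times \<beta> t u"
  unfolding tensor_times_def by (rule clinear_scaleC[OF outer_bilinear(2)])

lemma times_zero_left: "tensor_times \<beta> 0 u = 0"
  by (simp add: tensor_times_def tensor_lift_zero outer_bilinear)

lemma times_add_right: "tensor_times \<beta> t (u + u') = tensor_times \<beta> t u + tensor_times \<beta> t u'"
proof (induction t)
  case (elem x y)
  show ?case unfolding tensor_times_def tensor_lift_elem[OF outer_bilinear(1)]
    by (rule tensor_lift_add[OF inner_bilinear(1)])
qed (simp_all add: times_zero_left times_add_left)

lemma times_scale_right: "tensor_times \<beta> t (c *\<^sub>C u) = c *\<^sub>C tensor_times \<beta> t u"
proof (induction t)
  case (elem x y)
  show ?case unfolding tensor_times_def tensor_lift_elem[OF outer_bilinear(1)]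
    by (rule clinear_scaleC[OF inner_bilinear(2)])
qed (simp_all add: times_zero_left times_add_left scaleC_add_right)

lemma times_zero_right: "tensor_times \<beta> t 0 = 0"
  using times_add_right[of t 0 0] by simp

lemmas times_simps = times_elem times_add_left times_add_right times_zero_left times_zero_right
  times_scale_left times_scale_right

end

interpretation mult: cbilinear "(*) :: 'a::complex_star_algebra \<Rightarrow> 'a \<Rightarrow> 'a"
  by unfold_locales (simp_all add: distrib_left distrib_right mult_scaleC_left mult_scaleC_right)

interpretation elem_tensor: cbilinear elem_tensor
  by unfold_locales (simp_all add: tensor_add_left tensor_add_right tensor_scaleC_left
      tensor_scaleC_right)

interpretation lcomp: cbilinear lcomp
  by unfold_locales (simp_all add: lcomp_bilinear)

lemma balanced_star: "balanced (\<lambda>x y. star x \<otimes> star y)"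
  by (simp add: balanced_def star_add star_scaleC tensor_add_left tensor_add_right
      tensor_scaleC_left tensor_scaleC_right)

lemma tensor_map_star_simps:
  "tensor_map star star 0 = 0" "tensor_map star star (x \<otimes> y) = star x \<otimes> star y"
  "tensor_map star star (t + u) = tensor_map star star t + tensor_map star star u"
  by (simp_all add: tensor_map_def balanced_star tensor_lift_zero tensor_lift_elem tensor_lift_add)

instantiation tensor :: (complex_star_algebra, complex_star_algebra) complex_star_algebra
begin
definition times_tensor :: "('a, 'b) tensor \<Rightarrow> ('a, 'b) tensor \<Rightarrow> ('a, 'b) tensor" where
  "times_tensor = tensor_times (*)"
definition one_tensor :: "('a, 'b) tensor" where
  "one_tensor = 1 \<otimes> 1"
definition star_tensor :: "('a, 'b) tensor \<Rightarrow> ('a, 'b) tensor" where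
  "star_tensor = tensor_map star star"
instance
proof
  fix t u v :: "('a, 'b) tensor" and c :: complex
  note [simp] = times_tensor_def one_tensor_def star_tensor_def mult.times_simps
    tensor_map_star_simps star_mult star_star star_add
  have 1: "(x \<otimes> y) * (x' \<otimes> y') * v = (x \<otimes> y) * ((x' \<otimes> y') * v)" for x x' :: 'a and y y' :: 'b
    by (induction v) (simp_all add: mult.assoc)
  have 2: "(x \<otimes> y) * u * v = (x \<otimes> y) * (u * v)" for x :: 'a and y :: 'b
    by (induction u) (use 1 in simp_all)
  show "t * u * v = t * (u * v)" by (induction t) (use 2 in simp_all)
  show "(t + u) * v = t * v + u * v" "t * (u + v) = t * u + t * v"
    "(c *\<^sub>C t) * u = c *\<^sub>C (t * u)" "t * (c *\<^sub>C u) = c *\<^sub>C (t * u)" by simp_all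
  show "1 * t = t" "t * 1 = t" by (induction t) simp_all
  show "star (t + u) = star t + star u" by simp
  show "star (c *\<^sub>C t) = cnj c *\<^sub>C star t"
  proof (induction t)
    case (elem x y)
    have "star (c *\<^sub>C (x \<otimes> y)) = tensor_map star star ((c *\<^sub>C x) \<otimes> y)"
      by (simp only: star_tensor_def tensor_scaleC_left)
    also have "\<dots> = star (c *\<^sub>C x) \<otimes> star y" by (rule tensor_map_star_simps)
    also have "\<dots> = cnj c *\<^sub>C (star x \<otimes> star y)" by (simp only: star_scaleC tensor_scaleC_left)
    finally show ?case by simp
  qed (simp_all add: scaleC_add_right)
  have 3: "star ((x \<otimes> y) * u) = star u * star (x \<otimes> y)" for x :: 'a and y :: 'b
    by (induction u) simp_all
  show "star (t * u) = star u * star t" by (induction t) (use 3 in simp_all)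
  show "star (star t) = t" by (induction t) simp_all
qed
end

lift_definition mult_map :: "(('b::complex_star_algebra, 'b) tensor, 'b) lmap"
  is "tensor_lift (*)"
  by (rule tensor_lift_clinear(2))
    (simp_all add: distrib_left distrib_right mult_scaleC_left mult_scaleC_right)

definition assoc_fun :: "('x::complex_vector, ('y::complex_vector, 'z::complex_vector) tensor) tensor
    \<Rightarrow> (('x, 'y) tensor, 'z) tensor" where
  "assoc_fun = tensor_lift (\<lambda>x. tensor_lift (\<lambda>y z. (x \<otimes> y) \<otimes> z))"

lemma assoc_inner:
  "balanced (\<lambda>y z. (x \<otimes> y) \<otimes> z)" "clinear (tensor_lift (\<lambda>y z. (x \<otimes> y) \<otimes> z))"
  by (rule tensor_lift_clinear; simp add: tensor_add_left tensor_add_right tensor_scaleC_left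
      tensor_scaleC_right)+

lemma assoc_outer: "clinear assoc_fun"
  unfolding assoc_fun_def
proof (rule tensor_lift_clinear(2))
  fix x x' :: 'a and t t' :: "('b, 'c) tensor" and c
  let ?\<gamma> = "\<lambda>x. tensor_lift (\<lambda>(y::'b) (z::'c). (x \<otimes> y) \<otimes> z)"
  show "?\<gamma> (x + x') t = ?\<gamma> x t + ?\<gamma> x' t"
    by (induction t, simp_all only: tensor_lift_zero[OF assoc_inner(1)] tensor_lift_elem[OF assoc_inner(1)]
        tensor_lift_add[OF assoc_inner(1)]) (simp_all add: tensor_add_left ac_simps)
  show "?\<gamma> (c *\<^sub>C x) t = c *\<^sub>C ?\<gamma> x t"
    by (induction t, simp_all only: tensor_lift_zero[OF assoc_inner(1)] tensor_lift_elem[OF assoc_inner(1)]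
        tensor_lift_add[OF assoc_inner(1)]) (simp_all add: tensor_scaleC_left scaleC_add_right ac_simps)
qed (rule clinear_add[OF assoc_inner(2)] clinear_scaleC[OF assoc_inner(2)])+

text \<open>\<open>x \<otimes> (y \<otimes> z) \<mapsto> (x \<otimes> y) \<otimes> z\<close>\<close>

lift_definition assoc_map :: "(('x::complex_vector, ('y::complex_vector, 'z::complex_vector) tensor)
    tensor, (('x, 'y) tensor, 'z) tensor) lmap" is assoc_fun
  by (rule assoc_outer)

definition subspace_tensor :: "'x::complex_vector set \<Rightarrow> 'y::complex_vector set \<Rightarrow>
    ('x, 'y) tensor set" where
  "subspace_tensor U V = complex_vector.span {u \<otimes> v | u v. u \<in> U \<and> v \<in> V}"


section \<open>Adjoints, C*-algebras and states\<close>

definition adjoint_wrt :: "('x \<Rightarrow> 'x \<Rightarrow> complex) \<Rightarrow> ('y \<Rightarrow> 'y \<Rightarrow> complex) \<Rightarrow>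
    ('x::complex_vector, 'y::complex_vector) lmap \<Rightarrow> ('y, 'x) lmap" where
  "adjoint_wrt ip\<^sub>X ip\<^sub>Y T = (THE S. \<forall>x y. ip\<^sub>X (S \<cdot> y) x = ip\<^sub>Y y (T \<cdot> x))"

definition cstar_norm :: "('a::complex_star_algebra \<Rightarrow> real) \<Rightarrow> bool" where
  "cstar_norm N \<longleftrightarrow>
    (\<forall>x. 0 \<le> N x) \<and> (\<forall>x. N x = 0 \<longleftrightarrow> x = 0) \<and> (\<forall>x y. N (x + y) \<le> N x + N y) \<and>
    (\<forall>c x. N (c *\<^sub>C x) = cmod c * N x) \<and> (\<forall>x y. N (x * y) \<le> N x * N y) \<and>
    (\<forall>x. N (star x * x) = (N x)\<^sup>2) \<and>
    (\<forall>X :: nat \<Rightarrow> 'a. (\<forall>e>0. \<exists>k. \<forall>m\<ge>k. \<forall>n\<ge>k. N (X m - X n) < e) \<longrightarrow>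
      (\<exists>l. (\<lambda>n. N (X n - l)) \<longlonglongrightarrow> 0))"

definition cstar_algebra :: "'a::complex_star_algebra itself \<Rightarrow> bool" where
  "cstar_algebra _ \<longleftrightarrow> (\<exists>N :: 'a \<Rightarrow> real. cstar_norm N)"

definition state :: "('a::complex_star_algebra, complex) lmap \<Rightarrow> bool" where
  "state \<psi> \<longleftrightarrow> \<psi> \<cdot> 1 = 1 \<and> (\<forall>x. \<psi> \<cdot> (star x * x) \<in> \<real>\<^sub>\<ge>\<^sub>0)"

definition faithful :: "('a::complex_star_algebra, complex) lmap \<Rightarrow> bool" where
  "faithful \<psi> \<longleftrightarrow> (\<forall>x. \<psi> \<cdot> (star x * x) = 0 \<longrightarrow> x = 0)"

definition unital_star_hom ::
  "('a::complex_star_algebra, 'b::complex_star_algebra) lmap \<Rightarrow> bool" where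
  "unital_star_hom f \<longleftrightarrow> f \<cdot> 1 = 1 \<and> (\<forall>x y. f \<cdot> (x * y) = (f \<cdot> x) * (f \<cdot> y)) \<and>
    (\<forall>x. f \<cdot> star x = star (f \<cdot> x))"


section \<open>Quantum sets and quantum graphs\<close>

definition L2_inner :: "('b::complex_star_algebra, complex) lmap \<Rightarrow> 'b \<Rightarrow> 'b \<Rightarrow> complex" where
  "L2_inner \<psi> x y = \<psi> \<cdot> (star x * y)"

text \<open>\<open>\<psi> \<otimes> \<phi>\<close> with \<open>\<complex> \<otimes> \<complex>\<close> identified with \<open>\<complex>\<close> by multiplication\<close>

definition functional_tensor :: "('b::complex_star_algebra, complex) lmap \<Rightarrow>
    ('c::complex_star_algebra, complex) lmap \<Rightarrow> (('b, 'c) tensor, complex) lmap" where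
  "functional_tensor \<psi> \<phi> = mult_map \<circ>\<^sub>L (\<psi> \<otimes>\<^sub>L \<phi>)"

definition comult :: "('b::complex_star_algebra, complex) lmap \<Rightarrow> ('b, ('b, 'b) tensor) lmap" where
  "comult \<psi> = adjoint_wrt (L2_inner (functional_tensor \<psi> \<psi>)) (L2_inner \<psi>) mult_map"

definition quantum_set :: "('b::complex_star_algebra, complex) lmap \<Rightarrow> real \<Rightarrow> bool" where
  "quantum_set \<psi> \<delta> \<longleftrightarrow>
    finite_dim (UNIV :: 'b set) \<and> cstar_algebra TYPE('b) \<and> state \<psi> \<and> faithful \<psi> \<and>
    0 \<le> \<delta> \<and> mult_map \<circ>\<^sub>L comult \<psi> = complex_of_real (\<delta>\<^sup>2) *\<^sub>C lid"

definition schur :: "('b::complex_star_algebra, complex) lmap \<Rightarrow> real \<Rightarrow>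
    ('b, 'b) lmap \<Rightarrow> ('b, 'b) lmap \<Rightarrow> ('b, 'b) lmap" where
  "schur \<psi> \<delta> S T = complex_of_real (1 / \<delta>\<^sup>2) *\<^sub>C (mult_map \<circ>\<^sub>L (S \<otimes>\<^sub>L T) \<circ>\<^sub>L comult \<psi>)"

definition quantum_graph :: "('b::complex_star_algebra, complex) lmap \<Rightarrow> real \<Rightarrow>
    ('b, 'b) lmap \<Rightarrow> bool" where
  "quantum_graph \<psi> \<delta> A \<longleftrightarrow> quantum_set \<psi> \<delta> \<and> schur \<psi> \<delta> A A = A"

definition quantum_relation :: "('b::complex_star_algebra, complex) lmap \<Rightarrow> real \<Rightarrow>
    ('b, 'b) lmap \<Rightarrow> ('b, 'b) lmap set" where
  "quantum_relation \<psi> \<delta> A = range (schur \<psi> \<delta> A)"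

definition op_to_tensor :: "('b::complex_star_algebra, complex) lmap \<Rightarrow> ('b, 'b) lmap \<Rightarrow>
    ('b, 'b) tensor" where
  "op_to_tensor \<psi> T = (lid \<otimes>\<^sub>L T) \<cdot> comult \<psi> \<cdot> 1"

definition op_inner :: "('b::complex_star_algebra, complex) lmap \<Rightarrow>
    ('b, 'b) lmap \<Rightarrow> ('b, 'b) lmap \<Rightarrow> complex" where
  "op_inner \<psi> S T =
    L2_inner (functional_tensor \<psi> \<psi>) (op_to_tensor \<psi> S) (op_to_tensor \<psi> T)"

definition op_orthogonal :: "('b::complex_star_algebra, complex) lmap \<Rightarrow>
    ('b, 'b) lmap set \<Rightarrow> ('b, 'b) lmap set" where
  "op_orthogonal \<psi> U = {S. \<forall>T\<in>U. op_inner \<psi> T S = 0}"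

definition R_map :: "('b::complex_star_algebra, complex) lmap \<Rightarrow> ('b, 'b) lmap \<Rightarrow>
    (('b, 'b) tensor, ('b, 'b) tensor) lmap" where
  "R_map \<psi> A = (mult_map \<otimes>\<^sub>L lid) \<circ>\<^sub>L assoc_map \<circ>\<^sub>L (lid \<otimes>\<^sub>L (A \<otimes>\<^sub>L lid)) \<circ>\<^sub>L (lid \<otimes>\<^sub>L comult \<psi>)"


section \<open>Operators with coefficients in an algebra\<close>

text \<open>Since the spaces \<open>L\<^sup>2(\<G>)\<close> are finite-dimensional, \<open>B(L\<^sup>2(\<G>), L\<^sup>2(\<H>))\<close> is the space of all linear
  maps.

  \<open>op_of f\<close> is the element of \<open>B(X, Y) \<otimes> \<A>\<close> that corresponds to \<open>f : X \<rightarrow> Y \<otimes> \<A>\<close>, i.e. that gives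
  \<open>f x\<close> when the first leg is evaluated at \<open>x\<close>.\<close>

definition eval_op :: "'x::complex_vector \<Rightarrow> (('x, 'y::complex_vector) lmap, 'a::complex_vector) tensor
    \<Rightarrow> ('y, 'a) tensor" where
  "eval_op x = tensor_map (\<lambda>T. T \<cdot> x) id"

definition op_of :: "('x::complex_vector, ('y::complex_vector, 'a::complex_vector) tensor) lmap \<Rightarrow>
    (('x, 'y) lmap, 'a) tensor" where
  "op_of f = (THE t. \<forall>x. eval_op x t = f \<cdot> x)"

lemma eval_op_simps:
  fixes x :: "'x::complex_vector"
    and T :: "('x, 'y::complex_vector) lmap" and a :: "'a::complex_vector"
    and t u :: "(('x, 'y) lmap, 'a) tensor"
  shows "eval_op x (0 :: (('x, 'y) lmap, 'a) tensor) = 0" "eval_op x (T \<otimes> a) = (T \<cdot> x) \<otimes> a" "eval_op x (t + u) = eval_op x t + eval_op x u"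
proof -
  have "balanced (\<lambda>(T :: ('x, 'y) lmap) (a::'a). (T \<cdot> x) \<otimes> id a)"
    by (rule tensor_lift_clinear(1)) (simp_all add: tensor_add_left tensor_add_right
        tensor_scaleC_left tensor_scaleC_right)
  then show "eval_op x (0 :: (('x, 'y) lmap, 'a) tensor) = 0" "eval_op x (T \<otimes> a) = (T \<cdot> x) \<otimes> a"
    "eval_op x (t + u) = eval_op x t + eval_op x u"
    by (simp_all add: eval_op_def tensor_map_def tensor_lift_zero tensor_lift_elem tensor_lift_add)
qed

lemma op_of_ex1:
  fixes f :: "('x::complex_vector, ('y::complex_vector, 'a::complex_vector) tensor) lmap"
  assumes "finite_dim (UNIV :: 'x set)"
  shows "\<exists>!t. \<forall>x. eval_op x t = f \<cdot> x"
proof -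
  obtain S :: "'x set" where S: "finite S" "UNIV \<subseteq> complex_vector.span S"
    using assms by (auto simp: finite_dim_def)
  obtain E :: "'x set" where E: "complex_vector.independent E" "UNIV \<subseteq> complex_vector.span E"
    using complex_vector.maximal_independent_subset[of UNIV] by auto
  have fin: "finite E"
    using complex_vector.independent_span_bound[OF S(1) E(1)] S(2) by auto
  define \<epsilon> where "\<epsilon> = (\<lambda>e x. complex_vector.representation E x e)"
  have [simp]: "x \<in> complex_vector.span E" for x using E(2) by auto
  have expand: "(\<Sum>e\<in>E. \<epsilon> e x *\<^sub>C e) = x" for x
    unfolding \<epsilon>_def using E fin complex_vector.sum_representation_eq[of E x E] by auto
  define unit :: "'x \<Rightarrow> 'y \<Rightarrow> ('x, 'y) lmap" where "unit e y = Abs_lmap (\<lambda>x. \<epsilon> e x *\<^sub>C y)" for e y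
  have unit: "unit e y \<cdot> x = \<epsilon> e x *\<^sub>C y" for e y x
    unfolding unit_def by (subst Abs_lmap_inverse)
      (use E in \<open>auto intro!: clinearI simp: \<epsilon>_def complex_vector.representation_add
        complex_vector.representation_scale scaleC_add_left scaleC_scaleC\<close>)
  have lapp_sum: "T \<cdot> (\<Sum>e\<in>E. g e) = (\<Sum>e\<in>E. T \<cdot> g e)"
    for T :: "('x, 'c::complex_vector) lmap" and g :: "'x \<Rightarrow> 'x"
    using fin by (induction E rule: finite_induct)
      (auto simp: lapp_add complex_vector.scale_zero_left
        lapp_scaleC[of T 0, simplified complex_vector.scale_zero_left])
  have T: "(\<Sum>e\<in>E. \<epsilon> e x *\<^sub>C T \<cdot> e) = T \<cdot> x" for x and T :: "('x, 'c::complex_vector) lmap"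
    by (subst (2) expand[of x, symmetric]) (simp add: lapp_sum lapp_scaleC)
  have bil: "balanced (\<lambda>y (a::'a). unit e y \<otimes> a)" for e
  proof -
    have "unit e (y + y') = unit e y + unit e y'" "unit e (c *\<^sub>C y) = c *\<^sub>C unit e y" for y y' c
      by (rule lmap_eqI; simp add: unit scaleC_add_right scaleC_scaleC mult.commute)+
    then show ?thesis
      by (intro tensor_lift_clinear(1)) (simp_all add: tensor_add_left tensor_add_right
          tensor_scaleC_left tensor_scaleC_right)
  qed
  define build where "build e = tensor_lift (\<lambda>y (a::'a). unit e y \<otimes> a)" for e
  have build: "build e 0 = 0" "build e (y \<otimes> a) = unit e y \<otimes> a"
    "build e (t + u) = build e t + build e u" for e y a t u
    by (simp_all add: build_def bil tensor_lift_zero tensor_lift_elem tensor_lift_add)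
  have eval_sum: "eval_op x (\<Sum>e\<in>E. h e) = (\<Sum>e\<in>E. eval_op x (h e))"
    for x and h :: "'x \<Rightarrow> (('x, 'y) lmap, 'a) tensor"
    using fin by (induction E rule: finite_induct) (auto simp: eval_op_simps)
  have eval_build: "eval_op x (build e t) = \<epsilon> e x *\<^sub>C t" for x e t
    by (induction t) (simp_all add: build eval_op_simps unit tensor_scaleC_left scaleC_add_right)
  have tensor_sum: "(\<Sum>e\<in>E. h e \<otimes> a) = (\<Sum>e\<in>E. h e) \<otimes> a"
    for h :: "'x \<Rightarrow> ('x, 'y) lmap" and a :: 'a
  proof -
    have "(0 :: ('x, 'y) lmap) \<otimes> a = 0"
      using tensor_add_left[of "0 :: ('x, 'y) lmap" 0 a] by simp
    then show ?thesis by (induction E rule: infinite_finite_induct) (auto simp: tensor_add_left)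
  qed
  have recover: "(\<Sum>e\<in>E. build e (eval_op e t)) = t" for t
  proof (induction t)
    case (elem S a)
    have "(\<Sum>e\<in>E. unit e (S \<cdot> e)) \<cdot> x = (\<Sum>e\<in>E. unit e (S \<cdot> e) \<cdot> x)" for x
      using fin by (induction E rule: finite_induct) auto
    then have "(\<Sum>e\<in>E. unit e (S \<cdot> e)) = S"
      by (intro lmap_eqI) (simp add: unit T)
    then show ?case by (simp add: eval_op_simps build tensor_sum)
  qed (simp_all add: eval_op_simps build sum.distrib)
  show ?thesis
  proof (rule ex1I)
    show "\<forall>x. eval_op x (\<Sum>e\<in>E. build e (f \<cdot> e)) = f \<cdot> x"
      by (simp add: eval_sum eval_build T)
    fix t assume "\<forall>x. eval_op x t = f \<cdot> x"
    then show "t = (\<Sum>e\<in>E. build e (f \<cdot> e))" using recover[of t] by simp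
  qed
qed

definition op_compose :: "(('y::complex_vector, 'z::complex_vector) lmap, 'a::complex_star_algebra)
    tensor \<Rightarrow> (('x::complex_vector, 'y) lmap, 'a) tensor \<Rightarrow> (('x, 'z) lmap, 'a) tensor" where
  "op_compose = tensor_times (\<circ>\<^sub>L)"

definition op_adjoint :: "('b::complex_star_algebra, complex) lmap \<Rightarrow>
    ('c::complex_star_algebra, complex) lmap \<Rightarrow> (('b, 'c) lmap, 'a::complex_star_algebra) tensor \<Rightarrow>
    (('c, 'b) lmap, 'a) tensor" where
  "op_adjoint \<psi> \<phi> = tensor_map (adjoint_wrt (L2_inner \<psi>) (L2_inner \<phi>)) star"

text \<open>\<open>f\<^sup>\<dagger> (T \<otimes> 1) f\<close>\<close>

definition pull_op :: "('b\<^sub>0::complex_star_algebra, complex) lmap \<Rightarrow>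
    ('b\<^sub>1::complex_star_algebra, complex) lmap \<Rightarrow>
    ('b\<^sub>1, ('b\<^sub>0, 'a::complex_star_algebra) tensor) lmap \<Rightarrow> ('b\<^sub>0, 'b\<^sub>0) lmap \<Rightarrow>
    (('b\<^sub>1, 'b\<^sub>1) lmap, 'a) tensor" where
  "pull_op \<psi>\<^sub>0 \<psi>\<^sub>1 f T =
    op_compose (op_adjoint \<psi>\<^sub>1 \<psi>\<^sub>0 (op_of f)) (op_compose (T \<otimes> 1) (op_of f))"

definition op_inner_leg :: "('b::complex_star_algebra, complex) lmap \<Rightarrow> ('b, 'b) lmap \<Rightarrow>
    (('b, 'b) lmap, 'a::complex_vector) tensor \<Rightarrow> 'a" where
  "op_inner_leg \<psi> S = tensor_lift (\<lambda>T a. op_inner \<psi> S T *\<^sub>C a)"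

text \<open>\<open>F (x \<otimes> y) = f(x)\<^sub>1\<^sub>3 f(y)\<^sub>2\<^sub>3\<close>\<close>

lift_definition F_map :: "('x::complex_vector, ('y::complex_vector, 'a::complex_star_algebra) tensor)
    lmap \<Rightarrow> (('x, 'x) tensor, (('y, 'y) tensor, 'a) tensor) lmap"
  is "\<lambda>f. tensor_lift (\<lambda>x y. tensor_times (\<otimes>) (f x) (f y))"
  by (rule tensor_lift_clinear(2))
    (simp_all add: clinear_add clinear_scaleC elem_tensor.times_simps)


section \<open>The hyperfinite $II_1$ factor and its ultrapowers\<close>

text \<open>The Hilbert space \<open>\<ell>\<^sup>2(\<nat>)\<close>\<close>

typedef ell2 = "{x :: nat \<Rightarrow> complex. summable (\<lambda>n. (cmod (x n))\<^sup>2)}"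
  morphisms coord Abs_ell2
  by (rule exI[of _ "\<lambda>_. 0"]) simp

setup_lifting type_definition_ell2

lemma square_summable_add:
  fixes x y :: "nat \<Rightarrow> complex"
  assumes "summable (\<lambda>n. (cmod (x n))\<^sup>2)" "summable (\<lambda>n. (cmod (y n))\<^sup>2)"
  shows "summable (\<lambda>n. (cmod (x n + y n))\<^sup>2)"
proof (rule summable_comparison_test)
  show "summable (\<lambda>n. 2 * (cmod (x n))\<^sup>2 + 2 * (cmod (y n))\<^sup>2)"
    using assms by (intro summable_add summable_mult)
  have "(cmod (x n + y n))\<^sup>2 \<le> 2 * (cmod (x n))\<^sup>2 + 2 * (cmod (y n))\<^sup>2" for n
  proof -
    have "(cmod (x n + y n))\<^sup>2 \<le> (cmod (x n) + cmod (y n))\<^sup>2"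
      by (intro power_mono norm_triangle_ineq) auto
    also have "\<dots> \<le> 2 * (cmod (x n))\<^sup>2 + 2 * (cmod (y n))\<^sup>2"
      using zero_le_power2[of "cmod (x n) - cmod (y n)"] by (simp add: power2_eq_square algebra_simps)
    finally show ?thesis .
  qed
  then show "\<exists>N. \<forall>n\<ge>N. norm ((cmod (x n + y n))\<^sup>2) \<le> 2 * (cmod (x n))\<^sup>2 + 2 * (cmod (y n))\<^sup>2"
    by simp
qed

instantiation ell2 :: complex_vector
begin
lift_definition zero_ell2 :: ell2 is "\<lambda>_. 0" by simp
lift_definition plus_ell2 :: "ell2 \<Rightarrow> ell2 \<Rightarrow> ell2" is "\<lambda>x y n. x n + y n"
  by (rule square_summable_add)
lift_definition uminus_ell2 :: "ell2 \<Rightarrow> ell2" is "\<lambda>x n. - x n" by simp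
lift_definition minus_ell2 :: "ell2 \<Rightarrow> ell2 \<Rightarrow> ell2" is "\<lambda>x y n. x n - y n"
  subgoal for x y using square_summable_add[of x "\<lambda>n. - y n"] by simp
  done
lift_definition scaleC_ell2 :: "complex \<Rightarrow> ell2 \<Rightarrow> ell2" is "\<lambda>c x n. c * x n"
  by (simp add: norm_mult power_mult_distrib)
instance
  by standard (transfer; force simp: algebra_simps)+
end

definition ell2_inner :: "ell2 \<Rightarrow> ell2 \<Rightarrow> complex" where
  "ell2_inner x y = (\<Sum>n. cnj (coord x n) * coord y n)"

definition ell2_norm :: "ell2 \<Rightarrow> real" where
  "ell2_norm x = sqrt (\<Sum>n. (cmod (coord x n))\<^sup>2)"

type_synonym ell2_op = "(ell2, ell2) lmap"

definition op_bound :: "ell2_op \<Rightarrow> real \<Rightarrow> bool" where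
  "op_bound T K \<longleftrightarrow> (\<forall>x. ell2_norm (T \<cdot> x) \<le> K * ell2_norm x)"

definition bounded_ops :: "ell2_op set" where
  "bounded_ops = {T. \<exists>K. op_bound T K}"

abbreviation ell2_adj :: "ell2_op \<Rightarrow> ell2_op" where
  "ell2_adj \<equiv> adjoint_wrt ell2_inner ell2_inner"

definition commutant :: "ell2_op set \<Rightarrow> ell2_op set" where
  "commutant M = {T \<in> bounded_ops. \<forall>S\<in>M. T \<circ>\<^sub>L S = S \<circ>\<^sub>L T}"

definition op_star_subalgebra :: "ell2_op set \<Rightarrow> bool" where
  "op_star_subalgebra M \<longleftrightarrow> M \<subseteq> bounded_ops \<and> complex_vector.subspace M \<and> lid \<in> M \<and>
    (\<forall>S\<in>M. \<forall>T\<in>M. S \<circ>\<^sub>L T \<in> M) \<and> (\<forall>T\<in>M. ell2_adj T \<in> M)"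

definition von_neumann_algebra :: "ell2_op set \<Rightarrow> bool" where
  "von_neumann_algebra M \<longleftrightarrow> op_star_subalgebra M \<and> commutant (commutant M) = M"

text \<open>Normal states are the functionals \<open>\<Sum>\<^sub>n \<langle>\<xi>\<^sub>n | \<sqdot> \<xi>\<^sub>n\<rangle>\<close> with \<open>\<Sum>\<^sub>n \<parallel>\<xi>\<^sub>n\<parallel>\<^sup>2 = 1\<close>.\<close>

definition faithful_normal_tracial_state :: "ell2_op set \<Rightarrow> (ell2_op \<Rightarrow> complex) \<Rightarrow> bool" where
  "faithful_normal_tracial_state M \<tau> \<longleftrightarrow>
    (\<exists>\<xi> :: nat \<Rightarrow> ell2. (\<lambda>n. (ell2_norm (\<xi> n))\<^sup>2) sums 1 \<and>
      (\<forall>T\<in>M. (\<lambda>n. ell2_inner (\<xi> n) (T \<cdot> \<xi> n)) sums \<tau> T)) \<and>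
    (\<forall>S\<in>M. \<forall>T\<in>M. \<tau> (S \<circ>\<^sub>L T) = \<tau> (T \<circ>\<^sub>L S)) \<and>
    (\<forall>T\<in>M. \<tau> (ell2_adj T \<circ>\<^sub>L T) = 0 \<longrightarrow> T = 0)"

text \<open>By Murray and von Neumann these algebras are all isomorphic. Every $II_1$ factor with separable
  predual acts faithfully and normally on \<open>\<ell>\<^sup>2(\<nat>)\<close>, so fixing this Hilbert space is no restriction.\<close>

definition hyperfinite_II1_factor :: "ell2_op set \<Rightarrow> (ell2_op \<Rightarrow> complex) \<Rightarrow> bool" where
  "hyperfinite_II1_factor M \<tau> \<longleftrightarrow>
    von_neumann_algebra M \<and> M \<inter> commutant M = range (\<lambda>c. c *\<^sub>C lid) \<and> \<not> finite_dim M \<and>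
    faithful_normal_tracial_state M \<tau> \<and>
    (\<exists>N :: nat \<Rightarrow> ell2_op set.
      (\<forall>k. op_star_subalgebra (N k) \<and> finite_dim (N k) \<and> N k \<subseteq> N (Suc k)) \<and>
      commutant (commutant (\<Union>k. N k)) = M)"

definition free_ultrafilter :: "nat filter \<Rightarrow> bool" where
  "free_ultrafilter \<omega> \<longleftrightarrow> \<omega> \<noteq> bot \<and> (\<forall>P. eventually P \<omega> \<or> eventually (\<lambda>n. \<not> P n) \<omega>) \<and>
    (\<forall>k. eventually (\<lambda>n. n \<noteq> k) \<omega>)"

definition bounded_sequences :: "ell2_op set \<Rightarrow> (nat \<Rightarrow> ell2_op) set" where
  "bounded_sequences M = {X. (\<forall>n. X n \<in> M) \<and> (\<exists>K. \<forall>n. op_bound (X n) K)}"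

text \<open>\<open>\<pi>\<close> exhibits the algebra as \<open>\<ell>\<^sup>\<infinity>(\<nat>, R) / {X. lim\<^sub>n\<^sub>\<rightarrow>\<^sub>\<omega> \<tau>(X\<^sub>n\<^sup>* X\<^sub>n) = 0}\<close>.\<close>

definition ultrapower_of_R :: "'a::complex_star_algebra itself \<Rightarrow> bool" where
  "ultrapower_of_R _ \<longleftrightarrow> (\<exists>\<omega> R \<tau>. free_ultrafilter \<omega> \<and> hyperfinite_II1_factor R \<tau> \<and>
    (\<exists>\<pi> :: (nat \<Rightarrow> ell2_op) \<Rightarrow> 'a.
      \<pi> ` bounded_sequences R = UNIV \<and> \<pi> (\<lambda>_. lid) = 1 \<and>
      (\<forall>X \<in> bounded_sequences R.
        (\<forall>c. \<pi> (\<lambda>n. c *\<^sub>C X n) = c *\<^sub>C \<pi> X) \<and> \<pi> (\<lambda>n. ell2_adj (X n)) = star (\<pi> X) \<and>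
        (\<pi> X = 0 \<longleftrightarrow> ((\<lambda>n. \<tau> (ell2_adj (X n) \<circ>\<^sub>L X n)) \<longlongrightarrow> 0) \<omega>) \<and>
        (\<forall>Y \<in> bounded_sequences R.
          \<pi> (\<lambda>n. X n + Y n) = \<pi> X + \<pi> Y \<and> \<pi> (\<lambda>n. X n \<circ>\<^sub>L Y n) = \<pi> X * \<pi> Y))))"


section \<open>The classes of algebras\<close>

datatype algebra_type = Loc | Q | QA | QC | CStar | Alg

fun algebra_class :: "algebra_type \<Rightarrow> 'a::complex_star_algebra itself \<Rightarrow> bool" where
  "algebra_class Loc _ \<longleftrightarrow>
    (\<exists>h :: (complex, 'a) lmap. unital_star_hom h \<and> bij (lapp h))"
| "algebra_class Q _ \<longleftrightarrow> finite_dim (UNIV :: 'a set)"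
| "algebra_class QA _ \<longleftrightarrow> ultrapower_of_R TYPE('a)"
| "algebra_class QC _ \<longleftrightarrow> cstar_algebra TYPE('a) \<and>
    (\<exists>\<tau> :: ('a, complex) lmap. state \<tau> \<and> (\<forall>x y. \<tau> \<cdot> (x * y) = \<tau> \<cdot> (y * x)))"
| "algebra_class CStar _ \<longleftrightarrow> cstar_algebra TYPE('a)"
| "algebra_class Alg _ \<longleftrightarrow> True"

definition all_equivalent :: "bool list \<Rightarrow> bool" where
  "all_equivalent ps \<longleftrightarrow> (\<forall>p \<in> set ps. \<forall>q \<in> set ps. p \<longleftrightarrow> q)"

end

theory Submission
  imports Defs
begin

text \<open>Write \<open>P\<^sub>i\<close> for the map \<open>T \<mapsto> A\<^sub>i \<bullet> T\<close>, whose range is the quantum relation of the \<open>i\<close>-th graph, and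
  \<open>pull T\<close> for \<open>f\<^sup>\<dagger> (T \<otimes> 1) f\<close>. The Schur product is associative (\<open>schur_assoc\<close>), so \<open>A\<^sub>1 \<bullet> A\<^sub>1 = A\<^sub>1\<close> makes \<open>P\<^sub>1\<close>
  an idempotent. Everything is compared with the condition that \<open>P\<^sub>1 \<otimes> id\<close> fixes \<open>pull (P\<^sub>0 T)\<close>.

  An idempotent tensored with the identity fixes exactly the elements of its range tensored with
  the coefficient algebra, which gives the inclusion of relations
  (\<open>tensor_map_fixes_iff_subspace_tensor\<close>). In general \<open>P\<^sub>1\<close> is not an orthogonal projection. The
  orthogonality condition is equivalent all the same: for every functional \<open>\<chi>\<close> the functional
  \<open>\<chi> - \<chi> \<circ> P\<^sub>1\<close> vanishes on the range of \<open>P\<^sub>1\<close>, so it is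
  the inner product with an element of the orthogonal complement
  (\<open>tensor_map_fixes_iff_orthogonal\<close>).

  The condition on \<open>R\<close> and \<open>F\<close> is the transpose of the condition on \<open>P\<^sub>1\<close>. The pairing
  \<open>\<langle>x \<otimes> y, T\<rangle> = \<psi>(x T(y))\<close> between \<open>B \<otimes> B\<close> and the operators on \<open>B\<close> is perfect. Under it \<open>R\<^bsub>A\<^esub>\<close> is \<open>\<delta>\<^sup>2\<close> times the
  transpose of \<open>T \<mapsto> A \<bullet> T\<close> (\<open>op_pairing_R_map\<close>), and \<open>F\<close> is the transpose of \<open>pull\<close>
  (\<open>slice_pull_op\<close>); the second fact is where the compatibility of \<open>f\<close> with the involution,
  \<open>f(x\<^sup>*)\<^sup>* = f(x)\<close>, turns an adjoint into a product. The transpose of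
  \<open>(P\<^sub>1 \<otimes> id) \<circ> pull \<circ> P\<^sub>0 = pull \<circ> P\<^sub>0\<close> is then the identity for \<open>R\<close> and \<open>F\<close> up to the factor \<open>\<delta>\<^sub>0\<^sup>2\<close>, which is
  nonzero (\<open>quantum_set_delta_nonzero\<close>).

  Two devices make this explicit. Equalities with coefficients in an algebra are tested by the
  slices \<open>\<phi> \<otimes> id\<close>. Computations in \<open>L\<^sup>2(B, \<psi>)\<close> use a finite set \<open>E\<close> with
  \<open>\<Sum>\<^sub>e \<langle>e|x\<rangle> e = x\<close>, for which \<open>m\<^sup>\<dagger>(x) = \<Sum>\<^sub>e e \<otimes> e\<^sup>* x\<close> (\<open>comult_frame\<close>).\<close>

section \<open>Linear maps on tensor products\<close>

lemma lmap_eq_iff: "S = T \<longleftrightarrow> (\<forall>x. S \<cdot> x = T \<cdot> x)"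
  by (auto intro: lmap_eqI)

lemma clinear_sum: "clinear f \<Longrightarrow> f (\<Sum>i\<in>I. g i) = (\<Sum>i\<in>I. f (g i))"
  by (simp add: Vector_Spaces.linear_iff_module_hom module_hom.sum)

lemma clinear_zero: "clinear f \<Longrightarrow> f 0 = 0"
  by (simp add: Vector_Spaces.linear_iff_module_hom module_hom.zero)

lemma clinear_diff: "clinear f \<Longrightarrow> f (x - y) = f x - f y"
  by (simp add: Vector_Spaces.linear_iff_module_hom module_hom.diff)

lemmas lapp_sum = clinear_sum[OF lapp_clinear]
  and lapp_zero = clinear_zero[OF lapp_clinear]

lemma sum_lapp: "(\<Sum>i\<in>I. T i) \<cdot> x = (\<Sum>i\<in>I. T i \<cdot> x)"
  by (induction I rule: infinite_finite_induct) auto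

lemma clinear_elem_tensor_left: "clinear (\<lambda>x. x \<otimes> y)"
  by (rule clinearI) (simp_all add: tensor_add_left tensor_scaleC_left)

lemma clinear_elem_tensor_right: "clinear (\<lambda>y. x \<otimes> y)"
  by (rule clinearI) (simp_all add: tensor_add_right tensor_scaleC_right)

lemmas tensor_sum_left = clinear_sum[OF clinear_elem_tensor_left]
  and tensor_sum_right = clinear_sum[OF clinear_elem_tensor_right]

lemma tensor_map_simps:
  assumes "clinear g" "clinear h"
  shows "tensor_map g h (x \<otimes> y) = g x \<otimes> h y"
    and "clinear (tensor_map g h)"
proof -
  have "balanced (\<lambda>x y. g x \<otimes> h y) \<and> clinear (tensor_map g h)"
    unfolding tensor_map_def
    by (intro conjI; rule tensor_lift_clinear; simp add: assms clinear_add clinear_scaleC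
        tensor_add_left tensor_add_right tensor_scaleC_left tensor_scaleC_right)
  then show "tensor_map g h (x \<otimes> y) = g x \<otimes> h y" "clinear (tensor_map g h)"
    by (simp_all add: tensor_map_def tensor_lift_elem)
qed

lemma ltensor_elem [simp]: "(S \<otimes>\<^sub>L T) \<cdot> (x \<otimes> y) = (S \<cdot> x) \<otimes> (T \<cdot> y)"
  by (simp add: ltensor.rep_eq tensor_map_simps lapp_clinear)

lemma mult_map_elem [simp]: "mult_map \<cdot> (x \<otimes> y) = x * y"
  unfolding mult_map.rep_eq
  by (rule tensor_lift_elem) (simp add: balanced_def distrib_left distrib_right mult_scaleC_left
      mult_scaleC_right)

lemma assoc_map_elem [simp]:
  fixes x :: "'a::complex_vector" and y :: "'b::complex_vector" and z :: "'c::complex_vector"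
  shows "assoc_map \<cdot> (x \<otimes> (y \<otimes> z)) = (x \<otimes> y) \<otimes> z"
proof -
  let ?\<gamma> = "\<lambda>x :: 'a. tensor_lift (\<lambda>(y::'b) (z::'c). (x \<otimes> y) \<otimes> z)"
  have "balanced ?\<gamma>"
  proof (rule tensor_lift_clinear(1))
    fix x x' :: 'a and t t' :: "('b, 'c) tensor" and c
    show "?\<gamma> (x + x') t = ?\<gamma> x t + ?\<gamma> x' t"
      by (induction t, simp_all only: tensor_lift_zero[OF assoc_inner(1)]
          tensor_lift_elem[OF assoc_inner(1)] tensor_lift_add[OF assoc_inner(1)]) (simp_all add: tensor_add_left ac_simps)
    show "?\<gamma> (c *\<^sub>C x) t = c *\<^sub>C ?\<gamma> x t"
      by (induction t, simp_all only: tensor_lift_zero[OF assoc_inner(1)]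
          tensor_lift_elem[OF assoc_inner(1)] tensor_lift_add[OF assoc_inner(1)]) (simp_all add: tensor_scaleC_left scaleC_add_right)
  qed (rule clinear_add[OF assoc_inner(2)] clinear_scaleC[OF assoc_inner(2)])+
  then show ?thesis
    by (simp add: assoc_map.rep_eq assoc_fun_def tensor_lift_elem assoc_inner(1))
qed

lemma F_map_elem: "F_map f \<cdot> (x \<otimes> y) = tensor_times (\<otimes>) (f \<cdot> x) (f \<cdot> y)"
  unfolding F_map.rep_eq
  by (rule tensor_lift_elem) (simp add: balanced_def lapp_add lapp_scaleC elem_tensor.times_simps)

lemma clinear_id: "clinear id"
  by (rule clinearI) simp_all

lemma tensor_map_id_simps:
  fixes g :: "'x::complex_vector \<Rightarrow> 'u::complex_vector" and t u :: "('x, 'y::complex_vector) tensor"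
  assumes "clinear g"
  shows "tensor_map g id (x \<otimes> y) = g x \<otimes> y"
    and "clinear (tensor_map g id :: ('x, 'y) tensor \<Rightarrow> _)"
    and "tensor_map g id (0 :: ('x, 'y) tensor) = 0" and "tensor_map g id (t + u) = tensor_map g id t + tensor_map g id u"
proof -
  show lin: "clinear (tensor_map g id :: ('x, 'y) tensor \<Rightarrow> _)"
    by (rule tensor_map_simps(2)[OF assms clinear_id])
  show "tensor_map g id (x \<otimes> y) = g x \<otimes> y"
    by (simp add: tensor_map_simps(1)[OF assms clinear_id])
  show "tensor_map g id (0 :: ('x, 'y) tensor) = 0" "tensor_map g id (t + u) = tensor_map g id t + tensor_map g id u"
    by (rule clinear_zero[OF lin] clinear_add[OF lin])+
qed

definition rank_one :: "('x::complex_vector \<Rightarrow> complex) \<Rightarrow> 'y::complex_vector \<Rightarrow> ('x, 'y) lmap" where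
  "rank_one \<phi> y = Abs_lmap (\<lambda>x. \<phi> x *\<^sub>C y)"

lemma rank_one_lapp: "clinear \<phi> \<Longrightarrow> rank_one \<phi> y \<cdot> x = \<phi> x *\<^sub>C y"
  unfolding rank_one_def
  by (subst Abs_lmap_inverse)
    (auto intro!: clinearI simp: clinear_add clinear_scaleC scaleC_add_left scaleC_scaleC
      scaleC_complex_def)

section \<open>Slice maps\<close>

text \<open>The map \<open>\<phi> \<otimes> id\<close> with \<open>\<complex> \<otimes> \<A>\<close> identified with \<open>\<A>\<close>.\<close>

definition slice :: "('v::complex_vector \<Rightarrow> complex) \<Rightarrow> ('v, 'a::complex_vector) tensor \<Rightarrow> 'a" where
  "slice \<phi> = tensor_lift (\<lambda>v a. \<phi> v *\<^sub>C a)"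

lemma slice_simps:
  fixes \<phi> :: "'v::complex_vector \<Rightarrow> complex" and a :: "'a::complex_vector" and t u :: "('v, 'a) tensor"
  assumes "clinear \<phi>"
  shows "slice \<phi> (v \<otimes> a) = \<phi> v *\<^sub>C a" and "clinear (slice \<phi> :: ('v, 'a) tensor \<Rightarrow> 'a)"
    and "slice \<phi> (0 :: ('v, 'a) tensor) = 0" and "slice \<phi> (t + u) = slice \<phi> t + slice \<phi> u"
proof -
  have *: "balanced (\<lambda>v (a::'a). \<phi> v *\<^sub>C a) \<and> clinear (slice \<phi> :: ('v, 'a) tensor \<Rightarrow> 'a)"
    unfolding slice_def
    by (intro conjI; rule tensor_lift_clinear; simp add: clinear_add[OF assms] clinear_scaleC[OF assms]
        scaleC_add_right scaleC_add_left scaleC_scaleC scaleC_complex_def mult.commute)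
  then show "slice \<phi> (v \<otimes> a) = \<phi> v *\<^sub>C a"
    by (simp add: slice_def tensor_lift_elem)
  from * show lin: "clinear (slice \<phi> :: ('v, 'a) tensor \<Rightarrow> 'a)" ..
  show "slice \<phi> (0 :: ('v, 'a) tensor) = 0" "slice \<phi> (t + u) = slice \<phi> t + slice \<phi> u"
    by (rule clinear_zero[OF lin] clinear_add[OF lin])+
qed

lemma slice_tensor_map:
  assumes "clinear \<phi>" "clinear g"
  shows "slice \<phi> (tensor_map g id t) = slice (\<lambda>v. \<phi> (g v)) t"
proof -
  have \<phi>g: "clinear (\<lambda>v. \<phi> (g v))"
    using assms by (intro clinearI) (simp_all add: clinear_add clinear_scaleC)
  show ?thesis
    by (induction t) (simp_all only: slice_simps[OF assms(1)] slice_simps[OF \<phi>g]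
        tensor_map_id_simps[OF assms(2)])
qed

lemma slice_scaleC_functional:
  assumes "clinear \<phi>"
  shows "slice (\<lambda>v. c * \<phi> v) t = c *\<^sub>C slice \<phi> t"
proof -
  have c\<phi>: "clinear (\<lambda>v. c * \<phi> v)"
    using assms by (intro clinearI) (simp_all add: clinear_add clinear_scaleC distrib_left scaleC_complex_def)
  show ?thesis
    by (induction t) (simp_all add: slice_simps[OF assms] slice_simps[OF c\<phi>] scaleC_scaleC scaleC_add_right)
qed

lemma slice_add_functional:
  assumes "clinear \<phi>" "clinear \<chi>"
  shows "slice (\<lambda>v. \<phi> v + \<chi> v) t = slice \<phi> t + slice \<chi> t"
proof -
  have s: "clinear (\<lambda>v. \<phi> v + \<chi> v)"
    using assms by (intro clinearI) (simp_all add: clinear_add clinear_scaleC distrib_left scaleC_complex_def)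
  show ?thesis
    by (induction t) (simp_all add: slice_simps[OF assms(1)] slice_simps[OF assms(2)] slice_simps[OF s]
        scaleC_add_left)
qed

lemma slice_diff_functional:
  assumes "clinear \<phi>" "clinear \<chi>"
  shows "slice (\<lambda>v. \<phi> v - \<chi> v) t = slice \<phi> t - slice \<chi> t"
proof -
  have s: "clinear (\<lambda>v. \<phi> v - \<chi> v)"
    using assms by (intro clinearI) (simp_all add: clinear_add clinear_scaleC right_diff_distrib scaleC_complex_def)
  show ?thesis
    using slice_add_functional[OF s assms(2), of t] by simp
qed

lemma slice_ltensor_lid:
  fixes t :: "('v::complex_vector, 'a::complex_vector) tensor"
  assumes "clinear \<phi>"
  shows "slice \<phi> ((S \<otimes>\<^sub>L lid) \<cdot> t) = slice (\<lambda>v. \<phi> (S \<cdot> v)) t"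
proof -
  have "lapp lid = (id :: 'a \<Rightarrow> 'a)" by auto
  then show ?thesis
    by (simp only: ltensor.rep_eq slice_tensor_map[OF assms lapp_clinear])
qed

text \<open>A finite expansion of the vectors of the first leg lifts to the tensor product, with the
  slices as coefficients. Consequently such a family of functionals separates the tensors,
  whatever the second leg is.\<close>

lemma tensor_expansion:
  assumes "\<And>i. i \<in> I \<Longrightarrow> clinear (\<phi> i)" and "\<And>v. (\<Sum>i\<in>I. \<phi> i v *\<^sub>C b i) = v"
  shows "(\<Sum>i\<in>I. b i \<otimes> slice (\<phi> i) t) = t"
proof (induction t)
  case zero
  have "(\<Sum>i\<in>I. b i \<otimes> slice (\<phi> i) 0) = (\<Sum>i\<in>I. 0)"
    by (rule sum.cong) (simp_all add: slice_simps(3) assms(1) clinear_zero[OF clinear_elem_tensor_right])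
  then show ?case by simp
next
  case (elem v a)
  have "(\<Sum>i\<in>I. b i \<otimes> slice (\<phi> i) (v \<otimes> a)) = (\<Sum>i\<in>I. (\<phi> i v *\<^sub>C b i) \<otimes> a)"
    by (rule sum.cong) (simp_all add: slice_simps(1) assms(1) tensor_scaleC_right tensor_scaleC_left)
  also have "\<dots> = v \<otimes> a"
    by (simp only: assms(2) flip: tensor_sum_left)
  finally show ?case .
next
  case (add t u)
  have "(\<Sum>i\<in>I. b i \<otimes> slice (\<phi> i) (t + u)) = (\<Sum>i\<in>I. b i \<otimes> slice (\<phi> i) t + b i \<otimes> slice (\<phi> i) u)"
    by (rule sum.cong) (simp_all add: slice_simps(4) assms(1) tensor_add_right)
  then show ?case using add by (simp add: sum.distrib)
qed

lemma tensor_eqI_slice: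
  assumes "\<And>i. i \<in> I \<Longrightarrow> clinear (\<phi> i)" and "\<And>v. (\<Sum>i\<in>I. \<phi> i v *\<^sub>C b i) = v"
    and "\<And>i. i \<in> I \<Longrightarrow> slice (\<phi> i) t = slice (\<phi> i) u"
  shows "t = u"
proof -
  have "(\<Sum>i\<in>I. b i \<otimes> slice (\<phi> i) t) = (\<Sum>i\<in>I. b i \<otimes> slice (\<phi> i) u)"
    by (rule sum.cong) (simp_all add: assms(3))
  then show ?thesis by (simp only: tensor_expansion[OF assms(1,2)])
qed

lemma tensor_map_fixes_iff_subspace_tensor:
  assumes "clinear P" and "\<And>v. P (P v) = P v"
  shows "tensor_map P id t = t \<longleftrightarrow> t \<in> subspace_tensor (range P) UNIV"
proof
  note P = tensor_map_id_simps[OF assms(1)]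
  have "tensor_map P id s \<in> subspace_tensor (range P) UNIV" for s :: "('a, 'b) tensor"
    unfolding subspace_tensor_def
  proof (induction s)
    case zero
    show ?case by (simp only: P complex_vector.span_zero)
  next
    case (elem x y)
    show ?case unfolding P by (rule complex_vector.span_base) blast
  next
    case (add s s')
    then show ?case by (simp only: P complex_vector.span_add)
  qed
  then show "t \<in> subspace_tensor (range P) UNIV" if "tensor_map P id t = t"
    using that by metis
  show "tensor_map P id t = t" if "t \<in> subspace_tensor (range P) UNIV"
    using that unfolding subspace_tensor_def
  proof (induction rule: complex_vector.span_induct_alt)
    case base
    show ?case by (rule P)
  next
    case (step c x y)
    then obtain u a where "x = P u \<otimes> a" by blast
    with step(2) show ?case by (simp only: P assms(2) clinear_scaleC[OF P(2)])
  qed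
qed

section \<open>Parseval frames of a faithful state\<close>

lemma star_one [simp]: "star (1 :: 'a::complex_star_algebra) = 1"
  by (metis mult.left_neutral mult.right_neutral star_mult star_star)

lemma star_zero [simp]: "star (0 :: 'a::complex_star_algebra) = 0"
  using star_add[of 0 "0 :: 'a"] by simp

lemma star_sum: "star (\<Sum>i\<in>I. g i :: 'a::complex_star_algebra) = (\<Sum>i\<in>I. star (g i))"
  by (induction I rule: infinite_finite_induct) (simp_all add: star_add)

lemma L2_inner_add_left: "L2_inner \<psi> (x + x') y = L2_inner \<psi> x y + L2_inner \<psi> x' y"
  and L2_inner_add_right: "L2_inner \<psi> x (y + y') = L2_inner \<psi> x y + L2_inner \<psi> x y'"
  and L2_inner_scaleC_left: "L2_inner \<psi> (c *\<^sub>C x) y = cnj c * L2_inner \<psi> x y"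
  and L2_inner_scaleC_right: "L2_inner \<psi> x (c *\<^sub>C y) = c * L2_inner \<psi> x y"
  by (simp_all add: L2_inner_def star_add star_scaleC distrib_left distrib_right mult_scaleC_left
      mult_scaleC_right lapp_add lapp_scaleC scaleC_complex_def)

lemma clinear_L2_inner: "clinear (L2_inner \<psi> x)"
  by (rule clinearI) (simp_all add: L2_inner_add_right L2_inner_scaleC_right scaleC_complex_def)

lemma L2_inner_zero_left: "L2_inner \<psi> 0 y = 0"
  using L2_inner_add_left[of \<psi> 0 0 y] by simp

lemmas L2_inner_zero_right = clinear_zero[OF clinear_L2_inner]
  and L2_inner_diff_right = clinear_diff[OF clinear_L2_inner]
  and L2_inner_sum_right = clinear_sum[OF clinear_L2_inner]

lemma L2_inner_sum_left: "L2_inner \<psi> (\<Sum>i\<in>I. g i) y = (\<Sum>i\<in>I. L2_inner \<psi> (g i) y)"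
  by (induction I rule: infinite_finite_induct) (simp_all add: L2_inner_zero_left L2_inner_add_left)

text \<open>Polarization of the reality of \<open>\<psi>(x\<^sup>* x)\<close>, with the vectors \<open>1 + x\<close> and \<open>1 + \<i> x\<close>.\<close>

lemma state_hermitian:
  assumes "state \<psi>"
  shows "\<psi> \<cdot> star x = cnj (\<psi> \<cdot> x)"
proof -
  have real: "Im (L2_inner \<psi> y y) = 0" for y
    using assms by (auto simp: state_def L2_inner_def complex_nonneg_Reals_iff)
  have "Im (L2_inner \<psi> 1 x + L2_inner \<psi> x 1) = 0"
    using real[of "1 + x"] real[of 1] real[of x] by (simp add: L2_inner_add_left L2_inner_add_right)
  moreover have "Im (\<i> * L2_inner \<psi> 1 x - \<i> * L2_inner \<psi> x 1) = 0"
    using real[of "1 + \<i> *\<^sub>C x"] real[of 1] real[of x]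
    by (simp add: L2_inner_add_left L2_inner_add_right L2_inner_scaleC_left L2_inner_scaleC_right)
  ultimately show ?thesis
    by (simp add: L2_inner_def complex_eq_iff)
qed

lemma L2_inner_commute:
  assumes "\<And>x. \<psi> \<cdot> star x = cnj (\<psi> \<cdot> x)"
  shows "L2_inner \<psi> x y = cnj (L2_inner \<psi> y x)"
  by (simp add: L2_inner_def star_mult star_star flip: assms)

text \<open>Gram-Schmidt along a finite spanning set. The induction carries the expansion property
  in place of orthonormality: it is what makes the new vector orthogonal to the previous span.\<close>

lemma parseval_frame_exists:
  fixes \<psi> :: "('b::complex_star_algebra, complex) lmap"
  assumes "finite_dim (UNIV :: 'b set)" "state \<psi>" "faithful \<psi>"
  shows "\<exists>E. finite E \<and> (\<forall>x. (\<Sum>e\<in>E. L2_inner \<psi> e x *\<^sub>C e) = x)"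
proof -
  have herm: "L2_inner \<psi> x y = cnj (L2_inner \<psi> y x)" for x y
    by (rule L2_inner_commute[OF state_hermitian[OF assms(2)]])
  have "\<exists>E. finite E \<and> E \<subseteq> complex_vector.span S \<and>
    (\<forall>x \<in> complex_vector.span S. (\<Sum>e\<in>E. L2_inner \<psi> e x *\<^sub>C e) = x)" if "finite S" for S :: "'b set"
    using that
  proof (induction S rule: finite_induct)
    case empty
    show ?case by (rule exI[of _ "{}"]) simp
  next
    case (insert s S)
    then obtain E where E: "finite E" "E \<subseteq> complex_vector.span S"
      "\<And>x. x \<in> complex_vector.span S \<Longrightarrow> (\<Sum>e\<in>E. L2_inner \<psi> e x *\<^sub>C e) = x" by blast
    define p where "p = (\<Sum>e\<in>E. L2_inner \<psi> e s *\<^sub>C e)"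
    define r where "r = s - p"
    have p: "p \<in> complex_vector.span S"
      unfolding p_def using E(2) by (intro complex_vector.span_sum complex_vector.span_scale) auto
    have span_mono': "complex_vector.span S \<subseteq> complex_vector.span (insert s S)"
      by (rule complex_vector.span_mono) auto
    have r_span: "r \<in> complex_vector.span (insert s S)"
      unfolding r_def using p span_mono'
      by (intro complex_vector.span_diff) (auto intro: complex_vector.span_base)
    \<comment> \<open>\<open>p\<close> is the orthogonal projection of \<open>s\<close> to the span, since
      \<open>\<langle>x|p\<rangle> = \<Sum>\<^sub>e \<langle>x|e\<rangle>\<langle>e|s\<rangle>\<close> is the pairing of the expansion of \<open>x\<close> with \<open>s\<close>.\<close>
    have orth: "L2_inner \<psi> x r = 0" if "x \<in> complex_vector.span S" for x
    proof -
      have "L2_inner \<psi> x p = (\<Sum>e\<in>E. L2_inner \<psi> (L2_inner \<psi> e x *\<^sub>C e) s)"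
        unfolding p_def L2_inner_sum_right L2_inner_scaleC_right L2_inner_scaleC_left
        by (rule sum.cong[OF HOL.refl]) (simp add: herm[of x] mult.commute)
      also have "\<dots> = L2_inner \<psi> x s"
        by (simp only: E(3)[OF that] flip: L2_inner_sum_left)
      finally show ?thesis by (simp add: r_def L2_inner_diff_right)
    qed
    have decompose: "\<exists>y c. y \<in> complex_vector.span S \<and> x = y + c *\<^sub>C r"
      if x: "x \<in> complex_vector.span (insert s S)" for x
    proof -
      obtain c where c: "x - c *\<^sub>C s \<in> complex_vector.span S"
        using x unfolding complex_vector.span_insert by blast
      have "x = ((x - c *\<^sub>C s) + c *\<^sub>C p) + c *\<^sub>C r"
        by (simp add: r_def complex_vector.scale_right_diff_distrib)
      moreover have "(x - c *\<^sub>C s) + c *\<^sub>C p \<in> complex_vector.span S"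
        using c p by (intro complex_vector.span_add complex_vector.span_scale)
      ultimately show ?thesis by blast
    qed
    show ?case
    proof (cases "r = 0")
      case True
      have "complex_vector.span (insert s S) = complex_vector.span S"
        using decompose span_mono' by (auto simp: True)
      then show ?thesis using E by blast
    next
      case False
      define n where "n = L2_inner \<psi> r r"
      have n: "n \<in> \<real>\<^sub>\<ge>\<^sub>0" "n \<noteq> 0"
        using assms(2,3) False by (auto simp: n_def state_def faithful_def L2_inner_def)
      define k where "k = complex_of_real (1 / sqrt (Re n))"
      have "Im n = 0" "Re n > 0" using n by (auto simp: complex_nonneg_Reals_iff complex_eq_iff)
      then have k: "cnj k * n * k = 1"
        by (simp add: k_def complex_eq_iff flip: power2_eq_square)
      define e' where "e' = k *\<^sub>C r"
      have k0: "k \<noteq> 0" using k by auto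
      have notin: "e' \<notin> E"
      proof
        assume "e' \<in> E"
        then have "L2_inner \<psi> e' r = 0" using orth E(2) by blast
        then show False using n(2) k0 by (simp add: e'_def L2_inner_scaleC_left n_def)
      qed
      have "(\<Sum>e\<in>insert e' E. L2_inner \<psi> e x *\<^sub>C e) = x"
        if x: "x \<in> complex_vector.span (insert s S)" for x
      proof -
        obtain y c where yc: "y \<in> complex_vector.span S" "x = y + c *\<^sub>C r"
          using decompose[OF x] by blast
        have "L2_inner \<psi> e x = L2_inner \<psi> e y" if "e \<in> E" for e
          using orth[of e] that E(2) by (auto simp: yc L2_inner_add_right L2_inner_scaleC_right)
        then have 1: "(\<Sum>e\<in>E. L2_inner \<psi> e x *\<^sub>C e) = y"
          using E(3)[OF yc(1)] by simp
        have "L2_inner \<psi> e' y = 0"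
          using orth[OF yc(1)] herm[of r y] by (simp add: e'_def L2_inner_scaleC_left)
        then have "L2_inner \<psi> e' x *\<^sub>C e' = (cnj k * n * k * c) *\<^sub>C r"
          by (simp add: yc L2_inner_add_right L2_inner_scaleC_right e'_def L2_inner_scaleC_left
              n_def scaleC_scaleC mult_ac)
        then show ?thesis using 1 E(1) notin by (simp add: k yc(2))
      qed
      moreover have "insert e' E \<subseteq> complex_vector.span (insert s S)"
        using E(2) span_mono' r_span by (auto simp: e'_def intro: complex_vector.span_scale)
      ultimately show ?thesis using E(1) by (intro exI[of _ "insert e' E"]) simp
    qed
  qed
  moreover obtain S :: "'b set" where "finite S" "UNIV \<subseteq> complex_vector.span S"
    using assms(1) by (auto simp: finite_dim_def)
  ultimately show ?thesis by (metis UNIV_I subset_iff)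
qed

text \<open>Orthonormal bases are the linearly independent instances. The expansion property, rather than
  orthonormality, is the form in which \<open>E\<close> enters the computations.\<close>

locale parseval_frame =
  fixes \<psi> :: "('b::complex_star_algebra, complex) lmap" and E :: "'b set"
  assumes hermitian: "\<psi> \<cdot> star x = cnj (\<psi> \<cdot> x)"
    and expansion: "(\<Sum>e\<in>E. L2_inner \<psi> e x *\<^sub>C e) = x"
begin

lemma commute: "L2_inner \<psi> x y = cnj (L2_inner \<psi> y x)"
  by (rule L2_inner_commute[OF hermitian])

text \<open>The vectors \<open>e\<^sup>*\<close> give an expansion too, but with the coefficients \<open>\<psi>(x e)\<close> instead of \<open>\<psi>(e x)\<close>;
  the two differ as \<open>\<psi>\<close> need not be a trace.\<close>

lemma expansion_star: "(\<Sum>e\<in>E. L2_inner \<psi> (star x) e *\<^sub>C star e) = x"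
proof -
  have "(\<Sum>e\<in>E. L2_inner \<psi> (star x) e *\<^sub>C star e) = star (\<Sum>e\<in>E. L2_inner \<psi> e (star x) *\<^sub>C e)"
    unfolding star_sum star_scaleC by (simp flip: commute)
  then show ?thesis by (simp add: expansion star_star)
qed

lemma nondegenerate:
  assumes "\<And>x. L2_inner \<psi> u x = L2_inner \<psi> v x"
  shows "u = v"
proof -
  have "L2_inner \<psi> e u = L2_inner \<psi> e v" for e
    using assms[of e] by (metis commute)
  then have "(\<Sum>e\<in>E. L2_inner \<psi> e u *\<^sub>C e) = (\<Sum>e\<in>E. L2_inner \<psi> e v *\<^sub>C e)"
    by (simp only:)
  then show ?thesis by (simp only: expansion)
qed

lemma adjoint_wrt_eqI:
  assumes "\<And>x y. L2_inner \<psi> (S \<cdot> y) x = ip y (T \<cdot> x)"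
  shows "adjoint_wrt (L2_inner \<psi>) ip T = S"
  unfolding adjoint_wrt_def
  by (rule the_equality) (use assms in \<open>auto intro!: lmap_eqI nondegenerate\<close>)

text \<open>The adjoint exists because it can be written down as \<open>y \<mapsto> \<Sum>\<^sub>e \<langle>T e|y\<rangle> e\<close>.\<close>

lemma adjoint_wrt_L2_inner:
  assumes "\<And>x. \<phi> \<cdot> star x = cnj (\<phi> \<cdot> x)"
  shows "L2_inner \<psi> (adjoint_wrt (L2_inner \<psi>) (L2_inner \<phi>) T \<cdot> y) x = L2_inner \<phi> y (T \<cdot> x)"
proof -
  define S where "S = (\<Sum>e\<in>E. rank_one (L2_inner \<phi> (T \<cdot> e)) e)"
  have S: "L2_inner \<psi> (S \<cdot> y) x = L2_inner \<phi> y (T \<cdot> x)" for x y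
  proof -
    have "L2_inner \<psi> (S \<cdot> y) x = (\<Sum>e\<in>E. L2_inner \<psi> e x * L2_inner \<phi> y (T \<cdot> e))"
      unfolding S_def sum_lapp L2_inner_sum_left rank_one_lapp[OF clinear_L2_inner]
        L2_inner_scaleC_left
      by (simp add: mult.commute flip: L2_inner_commute[OF assms])
    also have "\<dots> = L2_inner \<phi> y (T \<cdot> (\<Sum>e\<in>E. L2_inner \<psi> e x *\<^sub>C e))"
      by (simp only: lapp_sum lapp_scaleC L2_inner_sum_right L2_inner_scaleC_right)
    finally show ?thesis by (simp only: expansion)
  qed
  show ?thesis unfolding adjoint_wrt_eqI[of S, OF S] by (rule S)
qed

lemma adjoint_wrt_conjugate_linear:
  assumes "\<And>x. \<phi> \<cdot> star x = cnj (\<phi> \<cdot> x)"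
  defines "adj \<equiv> adjoint_wrt (L2_inner \<psi>) (L2_inner \<phi>)"
  shows "adj (S + T) = adj S + adj T" and "adj (c *\<^sub>C T) = cnj c *\<^sub>C adj T"
  unfolding adj_def
  by (rule adjoint_wrt_eqI; simp add: L2_inner_add_left L2_inner_add_right L2_inner_scaleC_left
      L2_inner_scaleC_right adjoint_wrt_L2_inner[OF assms(1)])+

end

section \<open>The comultiplication and the Schur product\<close>

lemma times_tensor_elem: "(x \<otimes> y) * (x' \<otimes> y') = (x * x') \<otimes> (y * y')"
  by (simp add: times_tensor_def mult.times_elem)

lemma star_tensor_elem: "star (x \<otimes> y) = star x \<otimes> star y"
  by (simp add: star_tensor_def tensor_map_star_simps)

lemma L2_inner_tensor_elem:
  "L2_inner (functional_tensor \<psi> \<phi>) (x \<otimes> y) (x' \<otimes> y') = L2_inner \<psi> x x' * L2_inner \<phi> y y'"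
  by (simp add: L2_inner_def functional_tensor_def times_tensor_elem star_tensor_elem)

context parseval_frame
begin

text \<open>The tensors \<open>d \<otimes> e\<close> are a frame of \<open>B \<otimes> B\<close>; this makes the adjoint of the multiplication
  unique.\<close>

lemma tensor_nondegenerate:
  assumes "\<And>w. L2_inner (functional_tensor \<psi> \<psi>) u w = L2_inner (functional_tensor \<psi> \<psi>) v w"
  shows "u = v"
proof -
  have exp: "(\<Sum>d\<in>E. \<Sum>e\<in>E. cnj (L2_inner (functional_tensor \<psi> \<psi>) t (d \<otimes> e)) *\<^sub>C (d \<otimes> e)) = t" for t
  proof (induction t)
    case (elem x y)
    have "cnj (L2_inner (functional_tensor \<psi> \<psi>) (x \<otimes> y) (d \<otimes> e)) *\<^sub>C (d \<otimes> e) =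
        (L2_inner \<psi> d x *\<^sub>C d) \<otimes> (L2_inner \<psi> e y *\<^sub>C e)" for d e
      by (simp add: L2_inner_tensor_elem tensor_scaleC_left tensor_scaleC_right scaleC_scaleC
          flip: commute)
    then show ?case
      by (simp only: expansion flip: tensor_sum_left tensor_sum_right)
  qed (simp_all add: L2_inner_zero_left L2_inner_add_left scaleC_add_left sum.distrib)
  have "(\<Sum>d\<in>E. \<Sum>e\<in>E. cnj (L2_inner (functional_tensor \<psi> \<psi>) u (d \<otimes> e)) *\<^sub>C (d \<otimes> e)) =
      (\<Sum>d\<in>E. \<Sum>e\<in>E. cnj (L2_inner (functional_tensor \<psi> \<psi>) v (d \<otimes> e)) *\<^sub>C (d \<otimes> e))"
    by (simp only: assms)
  then show ?thesis by (simp only: exp)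
qed

text \<open>Pairing the right-hand side with \<open>a \<otimes> b\<close> gives \<open>\<Sum>\<^sub>e \<langle>e|a\<rangle> \<psi>(x\<^sup>* e b) = \<psi>(x\<^sup>* a b)\<close>.\<close>

lemma comult_frame: "comult \<psi> \<cdot> x = (\<Sum>e\<in>E. e \<otimes> (star e * x))"
proof -
  define D where "D = Abs_lmap (\<lambda>x. \<Sum>e\<in>E. e \<otimes> (star e * x))"
  have "clinear (\<lambda>x. \<Sum>e\<in>E. e \<otimes> (star e * x))"
    by (rule clinearI) (simp_all add: distrib_left tensor_add_right sum.distrib mult_scaleC_right
        tensor_scaleC_right complex_vector.scale_sum_right)
  then have D: "D \<cdot> x = (\<Sum>e\<in>E. e \<otimes> (star e * x))" for x
    by (simp add: D_def Abs_lmap_inverse)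
  have D_adj: "L2_inner (functional_tensor \<psi> \<psi>) (D \<cdot> y) u = L2_inner \<psi> y (mult_map \<cdot> u)" for y u
  proof (induction u)
    case (elem a b)
    have "L2_inner (functional_tensor \<psi> \<psi>) (D \<cdot> y) (a \<otimes> b) =
        (\<Sum>e\<in>E. L2_inner \<psi> e a * L2_inner \<psi> (star e * y) b)"
      by (simp add: D L2_inner_sum_left L2_inner_tensor_elem)
    also have "\<dots> = (\<Sum>e\<in>E. L2_inner \<psi> y ((L2_inner \<psi> e a *\<^sub>C e) * b))"
      by (simp add: mult_scaleC_left L2_inner_scaleC_right)
        (simp add: L2_inner_def star_mult star_star mult.assoc)
    also have "\<dots> = L2_inner \<psi> y (a * b)"
      by (simp only: expansion flip: L2_inner_sum_right sum_distrib_right)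
    finally show ?case by simp
  qed (simp_all add: lapp_zero lapp_add L2_inner_zero_right L2_inner_add_right)
  have "comult \<psi> = D"
    unfolding comult_def adjoint_wrt_def
    by (rule the_equality) (use D_adj in \<open>auto intro!: lmap_eqI tensor_nondegenerate\<close>)
  then show ?thesis by (simp add: D)
qed

lemma schur_frame:
  "schur \<psi> \<delta> S T \<cdot> x = complex_of_real (1 / \<delta>\<^sup>2) *\<^sub>C (\<Sum>e\<in>E. S \<cdot> e * T \<cdot> (star e * x))"
  by (simp add: schur_def comult_frame lapp_sum)

lemma clinear_schur: "clinear (schur \<psi> \<delta> A)"
  by (rule clinearI; rule lmap_eqI) (simp_all add: schur_frame distrib_left mult_scaleC_right
      sum.distrib scaleC_add_right scaleC_scaleC mult.commute flip: complex_vector.scale_sum_right)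

text \<open>The element \<open>\<Sum>\<^sub>e e \<otimes> e\<^sup>* = m\<^sup>\<dagger>(1)\<close> absorbs multiplication by \<open>a\<close> on the left of its first leg as
  multiplication on the right of its second leg. This bimodule property of \<open>m\<^sup>\<dagger>\<close> takes the
  place of coassociativity below.\<close>

lemma frame_balance:
  fixes g h :: "'b \<Rightarrow> 'c::complex_star_algebra"
  assumes "clinear g" "clinear h"
  shows "(\<Sum>e\<in>E. g (a * e) * h (star e)) = (\<Sum>e\<in>E. g e * h (star e * a))"
proof -
  have "g (a * e) = (\<Sum>d\<in>E. L2_inner \<psi> (star a * d) e *\<^sub>C g d)" for e
  proof -
    have "g (a * e) = g (\<Sum>d\<in>E. L2_inner \<psi> d (a * e) *\<^sub>C d)" by (simp only: expansion)
    also have "\<dots> = (\<Sum>d\<in>E. L2_inner \<psi> d (a * e) *\<^sub>C g d)"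
      by (simp only: clinear_sum[OF assms(1)] clinear_scaleC[OF assms(1)])
    finally show ?thesis by (simp add: L2_inner_def star_mult star_star mult.assoc)
  qed
  then have "(\<Sum>e\<in>E. g (a * e) * h (star e)) =
      (\<Sum>e\<in>E. \<Sum>d\<in>E. L2_inner \<psi> (star a * d) e *\<^sub>C (g d * h (star e)))"
    by (simp add: sum_distrib_right mult_scaleC_left)
  also have "\<dots> = (\<Sum>d\<in>E. \<Sum>e\<in>E. g d * h (L2_inner \<psi> (star a * d) e *\<^sub>C star e))"
    by (subst sum.swap) (simp add: mult_scaleC_right clinear_scaleC[OF assms(2)])
  also have "\<dots> = (\<Sum>d\<in>E. g d * h (star d * a))"
  proof (rule sum.cong[OF HOL.refl])
    fix d
    have "(\<Sum>e\<in>E. g d * h (L2_inner \<psi> (star a * d) e *\<^sub>C star e)) =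
        g d * h (\<Sum>e\<in>E. L2_inner \<psi> (star (star d * a)) e *\<^sub>C star e)"
      by (simp add: sum_distrib_left clinear_sum[OF assms(2)] star_mult star_star)
    then show "(\<Sum>e\<in>E. g d * h (L2_inner \<psi> (star a * d) e *\<^sub>C star e)) = g d * h (star d * a)"
      by (simp only: expansion_star)
  qed
  finally show ?thesis .
qed

text \<open>Both sides at \<open>x\<close> are \<open>\<delta>\<^sup>-\<^sup>4\<close> times \<open>\<Sum>\<^sub>d \<Sum>\<^sub>e S(d) T(\<sqdot>) U(\<sqdot> x)\<close>, with the arguments \<open>d\<^sup>* e\<close> and \<open>e\<^sup>*\<close> on
  one side and \<open>e\<close> and \<open>e\<^sup>* d\<^sup>*\<close> on the other; these agree by \<open>frame_balance\<close>.\<close>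

lemma schur_assoc: "schur \<psi> \<delta> S (schur \<psi> \<delta> T U) = schur \<psi> \<delta> (schur \<psi> \<delta> S T) U"
proof (rule lmap_eqI)
  fix x
  define k where "k = complex_of_real (1 / \<delta>\<^sup>2)"
  have T: "clinear (\<lambda>p. T \<cdot> p)" and U: "clinear (\<lambda>q. U \<cdot> (q * x))"
    by (rule clinearI; simp add: lapp_add lapp_scaleC distrib_right mult_scaleC_left)+
  have "schur \<psi> \<delta> (schur \<psi> \<delta> S T) U \<cdot> x =
      k *\<^sub>C k *\<^sub>C (\<Sum>e\<in>E. \<Sum>d\<in>E. S \<cdot> d * (T \<cdot> (star d * e) * U \<cdot> (star e * x)))"
    by (simp add: schur_frame k_def mult_scaleC_left sum_distrib_right mult.assoc
        flip: complex_vector.scale_sum_right)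
  also have "\<dots> = k *\<^sub>C k *\<^sub>C (\<Sum>d\<in>E. S \<cdot> d * (\<Sum>e\<in>E. T \<cdot> (star d * e) * U \<cdot> (star e * x)))"
    by (subst sum.swap) (simp add: sum_distrib_left)
  also have "\<dots> = k *\<^sub>C k *\<^sub>C (\<Sum>d\<in>E. S \<cdot> d * (\<Sum>e\<in>E. T \<cdot> e * U \<cdot> (star e * (star d * x))))"
    by (simp add: frame_balance[OF T U] mult.assoc)
  also have "\<dots> = schur \<psi> \<delta> S (schur \<psi> \<delta> T U) \<cdot> x"
    by (simp add: schur_frame k_def mult_scaleC_right flip: complex_vector.scale_sum_right)
  finally show "schur \<psi> \<delta> S (schur \<psi> \<delta> T U) \<cdot> x = schur \<psi> \<delta> (schur \<psi> \<delta> S T) U \<cdot> x" ..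
qed

end

lemma quantum_set_frame:
  fixes \<psi> :: "('b::complex_star_algebra, complex) lmap"
  assumes "quantum_set \<psi> \<delta>"
  shows "\<exists>E. parseval_frame \<psi> E"
  using parseval_frame_exists[of \<psi>] assms state_hermitian[of \<psi>]
  unfolding quantum_set_def parseval_frame_def by blast

text \<open>If \<open>\<delta> = 0\<close>, then \<open>m m\<^sup>\<dagger>(1) = \<Sum>\<^sub>e e e\<^sup>*\<close> vanishes, and faithfulness makes every frame vector zero,
  although \<open>1 \<noteq> 0\<close> because \<open>\<psi>(1) = 1\<close>.\<close>

lemma quantum_set_delta_nonzero:
  assumes "quantum_set \<psi> \<delta>"
  shows "\<delta> \<noteq> 0"
proof
  assume "\<delta> = 0"
  have state: "state \<psi>" and faithful: "faithful \<psi>" using assms by (auto simp: quantum_set_def)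
  obtain E where E: "finite E" "\<And>x. (\<Sum>e\<in>E. L2_inner \<psi> e x *\<^sub>C e) = x"
    using parseval_frame_exists[of \<psi>] assms by (auto simp: quantum_set_def)
  interpret parseval_frame \<psi> E
    by unfold_locales (use state_hermitian[OF state] E in auto)
  have "(mult_map \<circ>\<^sub>L comult \<psi>) \<cdot> 1 = 0"
    using assms \<open>\<delta> = 0\<close> by (simp add: quantum_set_def)
  then have "(\<Sum>e\<in>E. e * star e) = 0"
    by (simp add: comult_frame lapp_sum)
  then have "(\<Sum>e\<in>E. \<psi> \<cdot> (e * star e)) = 0"
    by (simp add: lapp_zero flip: lapp_sum)
  moreover have pos: "\<psi> \<cdot> (e * star e) \<in> \<real>\<^sub>\<ge>\<^sub>0" for e
    using state by (metis state_def star_star)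
  ultimately have "(\<Sum>e\<in>E. Re (\<psi> \<cdot> (e * star e))) = 0"
    by (simp flip: Re_sum)
  then have "Re (\<psi> \<cdot> (e * star e)) = 0" if "e \<in> E" for e
    using that pos by (subst (asm) sum_nonneg_eq_0_iff[OF E(1)]) (auto simp: complex_nonneg_Reals_iff)
  then have "\<psi> \<cdot> (star (star e) * star e) = 0" if "e \<in> E" for e
    using that pos[of e] by (auto simp: complex_nonneg_Reals_iff complex_eq_iff star_star)
  then have "star e = 0" if "e \<in> E" for e
    using that faithful unfolding faithful_def by blast
  then have zero: "e = 0" if "e \<in> E" for e
    using that star_star[of e] by simp
  have "(\<Sum>e\<in>E. L2_inner \<psi> e 1 *\<^sub>C e) = (\<Sum>e\<in>E. 0)"
    by (rule sum.cong[OF HOL.refl]) (simp add: zero)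
  then have "(1 :: 'a) = 0"
    by (simp add: expansion)
  then have "\<psi> \<cdot> 1 = 0" by (simp add: lapp_zero)
  then show False using state by (simp add: state_def)
qed

section \<open>The duality between operators and tensors\<close>

text \<open>The functional \<open>x \<otimes> y \<mapsto> \<psi>(x T(y))\<close>. It is linear in \<open>T\<close>, in contrast to
  \<open>\<langle>x|T y\<rangle> = \<psi>(x\<^sup>* T(y))\<close>, which would be conjugate-linear in \<open>x\<close>.\<close>

definition op_pairing :: "('b::complex_star_algebra, complex) lmap \<Rightarrow> ('b, 'b) lmap \<Rightarrow>
    (('b, 'b) tensor, complex) lmap" where
  "op_pairing \<psi> T = \<psi> \<circ>\<^sub>L mult_map \<circ>\<^sub>L (lid \<otimes>\<^sub>L T)"

lemma op_pairing_elem: "op_pairing \<psi> T \<cdot> (x \<otimes> y) = \<psi> \<cdot> (x * T \<cdot> y)"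
  by (simp add: op_pairing_def)

lemma clinear_op_pairing: "clinear (\<lambda>T. op_pairing \<psi> T \<cdot> w)"
proof (rule clinearI)
  fix S T :: "('a, 'a) lmap" and c
  show "op_pairing \<psi> (S + T) \<cdot> w = op_pairing \<psi> S \<cdot> w + op_pairing \<psi> T \<cdot> w"
    by (induction w) (simp_all add: op_pairing_elem distrib_left lapp_add lapp_zero)
  show "op_pairing \<psi> (c *\<^sub>C T) \<cdot> w = c *\<^sub>C op_pairing \<psi> T \<cdot> w"
    by (induction w) (simp_all add: op_pairing_elem mult_scaleC_right lapp_scaleC lapp_add lapp_zero
        scaleC_add_right)
qed

text \<open>With \<open>m\<^sup>\<dagger>(y) = \<Sum> y' \<otimes> y''\<close> the left-hand side at \<open>x \<otimes> y\<close> is \<open>\<Sum> \<psi>(x A(y') T(y''))\<close>, and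
  \<open>\<Sum> A(y') T(y'') = \<delta>\<^sup>2 (A \<bullet> T)(y)\<close>. So \<open>R\<^bsub>A\<^esub>\<close> is the transpose of \<open>A \<bullet> \<sqdot>\<close> up to \<open>\<delta>\<^sup>2\<close>.\<close>

lemma op_pairing_R_map:
  assumes "\<delta> \<noteq> 0"
  shows "op_pairing \<psi> T \<cdot> R_map \<psi> A \<cdot> u =
    complex_of_real (\<delta>\<^sup>2) * (op_pairing \<psi> (schur \<psi> \<delta> A T) \<cdot> u)"
proof (induction u)
  case (elem x y)
  have "op_pairing \<psi> T \<cdot> (mult_map \<otimes>\<^sub>L lid) \<cdot> assoc_map \<cdot> (lid \<otimes>\<^sub>L (A \<otimes>\<^sub>L lid)) \<cdot> (x \<otimes> z) =
      \<psi> \<cdot> (x * mult_map \<cdot> (A \<otimes>\<^sub>L T) \<cdot> z)" for z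
    by (induction z) (simp_all add: op_pairing_elem lapp_zero lapp_add distrib_left tensor_add_right
        clinear_zero[OF clinear_elem_tensor_right] mult.assoc)
  then show ?case
    using assms by (simp add: R_map_def schur_def op_pairing_elem lapp_scaleC mult_scaleC_right
        scaleC_complex_def)
qed (simp_all add: lapp_zero lapp_add distrib_left)

context parseval_frame
begin

text \<open>The tensors \<open>e\<^sup>* \<otimes> d\<close> and the operators \<open>y \<mapsto> \<langle>d|y\<rangle> e\<close> are dual to each other: this expansion and
  the next one say that the pairing is perfect on either side.\<close>

lemma op_expansion:
  "(\<Sum>(d, e)\<in>E \<times> E. (op_pairing \<psi> T \<cdot> (star e \<otimes> d)) *\<^sub>C rank_one (L2_inner \<psi> d) e) = T"
proof (rule lmap_eqI)
  fix x
  have "(\<Sum>(d, e)\<in>E \<times> E. (op_pairing \<psi> T \<cdot> (star e \<otimes> d)) *\<^sub>C rank_one (L2_inner \<psi> d) e) \<cdot> x =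
      (\<Sum>d\<in>E. \<Sum>e\<in>E. L2_inner \<psi> e (T \<cdot> d) *\<^sub>C L2_inner \<psi> d x *\<^sub>C e)"
    by (simp add: sum_lapp split_def op_pairing_elem rank_one_lapp[OF clinear_L2_inner]
        L2_inner_def sum.cartesian_product)
  also have "\<dots> = (\<Sum>d\<in>E. L2_inner \<psi> d x *\<^sub>C (\<Sum>e\<in>E. L2_inner \<psi> e (T \<cdot> d) *\<^sub>C e))"
    by (simp add: complex_vector.scale_sum_right scaleC_scaleC mult.commute)
  also have "\<dots> = T \<cdot> (\<Sum>d\<in>E. L2_inner \<psi> d x *\<^sub>C d)"
    by (simp only: expansion expansion_star flip: lapp_sum lapp_scaleC)
  finally show "(\<Sum>(d, e)\<in>E \<times> E. (op_pairing \<psi> T \<cdot> (star e \<otimes> d)) *\<^sub>C rank_one (L2_inner \<psi> d) e) \<cdot> x = T \<cdot> x"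
    by (simp only: expansion)
qed

lemma pairing_expansion:
  "(\<Sum>(d, e)\<in>E \<times> E. (op_pairing \<psi> (rank_one (L2_inner \<psi> d) e) \<cdot> u) *\<^sub>C (star e \<otimes> d)) = u"
proof (induction u)
  case (elem x y)
  have "(op_pairing \<psi> (rank_one (L2_inner \<psi> d) e) \<cdot> (x \<otimes> y)) *\<^sub>C (star e \<otimes> d) =
      (L2_inner \<psi> (star x) e *\<^sub>C star e) \<otimes> (L2_inner \<psi> d y *\<^sub>C d)" for d e
    by (simp add: op_pairing_elem rank_one_lapp[OF clinear_L2_inner] mult_scaleC_right lapp_scaleC
        L2_inner_def star_star scaleC_complex_def tensor_scaleC_left tensor_scaleC_right scaleC_scaleC
        mult.commute)
  then have "(\<Sum>(d, e)\<in>E \<times> E. (op_pairing \<psi> (rank_one (L2_inner \<psi> d) e) \<cdot> (x \<otimes> y)) *\<^sub>C (star e \<otimes> d)) =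
      (\<Sum>d\<in>E. \<Sum>e\<in>E. (L2_inner \<psi> (star x) e *\<^sub>C star e) \<otimes> (L2_inner \<psi> d y *\<^sub>C d))"
    by (simp add: sum.cartesian_product)
  then show ?case
    by (simp only: expansion expansion_star flip: tensor_sum_left tensor_sum_right)
qed (simp_all add: lapp_zero lapp_add scaleC_add_left split_def sum.distrib)

text \<open>Separation with coefficients: the next two rules test equality in \<open>B(L\<^sup>2) \<otimes> \<A>\<close> by tensors, and
  in \<open>(B \<otimes> B) \<otimes> \<A>\<close> by operators.\<close>

lemma op_tensor_eqI:
  assumes "\<And>w. slice (\<lambda>T. op_pairing \<psi> T \<cdot> w) t = slice (\<lambda>T. op_pairing \<psi> T \<cdot> w) u"
  shows "t = u"
  by (rule tensor_eqI_slice[where I = "E \<times> E"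
        and \<phi> = "\<lambda>(d, e) T. op_pairing \<psi> T \<cdot> (star e \<otimes> d)" and b = "\<lambda>(d, e). rank_one (L2_inner \<psi> d) e"])
    (use op_expansion assms in \<open>auto simp: clinear_op_pairing split_def\<close>)

lemma pairing_tensor_eqI:
  assumes "\<And>T. slice (\<lambda>w. op_pairing \<psi> T \<cdot> w) t = slice (\<lambda>w. op_pairing \<psi> T \<cdot> w) u"
  shows "t = u"
  by (rule tensor_eqI_slice[where I = "E \<times> E"
        and \<phi> = "\<lambda>(d, e) w. op_pairing \<psi> (rank_one (L2_inner \<psi> d) e) \<cdot> w" and b = "\<lambda>(d, e). star e \<otimes> d"])
    (use pairing_expansion assms in \<open>auto simp: lapp_clinear split_def\<close>)

lemma slice_schur:
  assumes "\<delta> \<noteq> 0"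
  shows "complex_of_real (\<delta>\<^sup>2) *\<^sub>C slice (\<lambda>T. op_pairing \<psi> T \<cdot> w) (tensor_map (schur \<psi> \<delta> A) id t) =
    slice (\<lambda>T. op_pairing \<psi> T \<cdot> R_map \<psi> A \<cdot> w) t"
proof -
  have schur_pairing: "clinear (\<lambda>T. op_pairing \<psi> (schur \<psi> \<delta> A T) \<cdot> w)"
    by (rule clinearI) (simp_all add: clinear_add[OF clinear_schur] clinear_scaleC[OF clinear_schur]
        clinear_add[OF clinear_op_pairing] clinear_scaleC[OF clinear_op_pairing])
  show ?thesis
    by (subst slice_tensor_map[OF clinear_op_pairing clinear_schur])
      (simp add: op_pairing_R_map[OF assms] slice_scaleC_functional[OF schur_pairing])
qed

end

section \<open>The inner product of operators\<close>

context parseval_frame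
begin

lemma op_to_tensor_frame: "op_to_tensor \<psi> T = (\<Sum>e\<in>E. e \<otimes> (T \<cdot> star e))"
  by (simp add: op_to_tensor_def comult_frame lapp_sum)

text \<open>By definition the inner product is \<open>\<Sum>\<^sub>d \<Sum>\<^sub>e \<langle>d|e\<rangle> \<langle>S d\<^sup>*|T e\<^sup>*\<rangle>\<close>; the sum over \<open>d\<close> collapses by
  \<open>expansion_star\<close> for \<open>e\<^sup>*\<close>.\<close>

lemma op_inner_frame: "op_inner \<psi> S T = (\<Sum>e\<in>E. L2_inner \<psi> (S \<cdot> star e) (T \<cdot> star e))"
proof -
  have "op_inner \<psi> S T =
      (\<Sum>e\<in>E. \<Sum>d\<in>E. L2_inner \<psi> (S \<cdot> (L2_inner \<psi> e d *\<^sub>C star d)) (T \<cdot> star e))"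
    by (simp add: op_inner_def op_to_tensor_frame L2_inner_sum_left L2_inner_sum_right
        L2_inner_tensor_elem lapp_scaleC L2_inner_scaleC_left flip: commute)
  also have "\<dots> = (\<Sum>e\<in>E. L2_inner \<psi> (S \<cdot> (\<Sum>d\<in>E. L2_inner \<psi> (star (star e)) d *\<^sub>C star d)) (T \<cdot> star e))"
    by (simp add: star_star lapp_sum L2_inner_sum_left)
  finally show ?thesis by (simp only: expansion_star)
qed

lemma op_inner_commute: "op_inner \<psi> S T = cnj (op_inner \<psi> T S)"
  by (simp add: op_inner_frame flip: commute)

lemma clinear_op_inner: "clinear (op_inner \<psi> S)"
  by (rule clinearI) (simp_all add: op_inner_frame L2_inner_add_right sum.distrib
      L2_inner_scaleC_right scaleC_complex_def sum_distrib_left)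

lemma op_inner_scaleC_left: "op_inner \<psi> (c *\<^sub>C S) T = cnj c * op_inner \<psi> S T"
  by (simp add: op_inner_frame L2_inner_scaleC_left sum_distrib_left)

lemma op_inner_sum_left: "op_inner \<psi> (\<Sum>i\<in>I. S i) T = (\<Sum>i\<in>I. op_inner \<psi> (S i) T)"
  by (subst op_inner_commute) (simp add: clinear_sum[OF clinear_op_inner] flip: op_inner_commute)

text \<open>The operators \<open>x \<mapsto> \<psi>(x d) e\<close> form a frame for the inner product, because the functionals
  \<open>\<psi>(\<sqdot> d)\<close> are the coefficients of the expansion in the vectors \<open>d\<^sup>*\<close> at which the inner product
  evaluates.\<close>

lemma op_inner_riesz:
  assumes "clinear \<chi>"
  shows "\<exists>S. \<chi> = op_inner \<psi> S"
proof -
  define U :: "'b \<Rightarrow> 'b \<Rightarrow> ('b, 'b) lmap" where "U d e = rank_one (\<lambda>x. \<psi> \<cdot> (x * d)) e" for d e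
  have U: "U d e \<cdot> x = L2_inner \<psi> (star x) d *\<^sub>C e" for d e x
    unfolding U_def by (subst rank_one_lapp)
      (auto intro: clinearI simp: distrib_right mult_scaleC_left lapp_add lapp_scaleC L2_inner_def star_star)
  have expand: "(\<Sum>d\<in>E. \<Sum>e\<in>E. L2_inner \<psi> e (T \<cdot> star d) *\<^sub>C U d e) = T" for T
  proof (rule lmap_eqI)
    fix x
    have "(\<Sum>d\<in>E. \<Sum>e\<in>E. L2_inner \<psi> e (T \<cdot> star d) *\<^sub>C U d e) \<cdot> x =
        (\<Sum>d\<in>E. L2_inner \<psi> (star x) d *\<^sub>C (\<Sum>e\<in>E. L2_inner \<psi> e (T \<cdot> star d) *\<^sub>C e))"
      by (simp add: sum_lapp U complex_vector.scale_sum_right scaleC_scaleC mult.commute)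
    also have "\<dots> = T \<cdot> (\<Sum>d\<in>E. L2_inner \<psi> (star x) d *\<^sub>C star d)"
      by (simp only: expansion expansion_star flip: lapp_sum lapp_scaleC)
    finally show "(\<Sum>d\<in>E. \<Sum>e\<in>E. L2_inner \<psi> e (T \<cdot> star d) *\<^sub>C U d e) \<cdot> x = T \<cdot> x"
      by (simp only: expansion_star)
  qed
  have inner: "op_inner \<psi> (U d e) T = L2_inner \<psi> e (T \<cdot> star d)" for d e T
  proof -
    have "op_inner \<psi> (U d e) T = L2_inner \<psi> e (T \<cdot> (\<Sum>c\<in>E. L2_inner \<psi> (star (star d)) c *\<^sub>C star c))"
      by (simp add: op_inner_frame U star_star L2_inner_scaleC_left lapp_sum lapp_scaleC
          L2_inner_sum_right L2_inner_scaleC_right flip: commute)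
    then show ?thesis by (simp only: expansion_star)
  qed
  have "\<chi> T = op_inner \<psi> (\<Sum>d\<in>E. \<Sum>e\<in>E. cnj (\<chi> (U d e)) *\<^sub>C U d e) T" for T
  proof -
    have "\<chi> T = \<chi> (\<Sum>d\<in>E. \<Sum>e\<in>E. L2_inner \<psi> e (T \<cdot> star d) *\<^sub>C U d e)" by (simp only: expand)
    also have "\<dots> = (\<Sum>d\<in>E. \<Sum>e\<in>E. \<chi> (U d e) * L2_inner \<psi> e (T \<cdot> star d))"
      by (simp add: clinear_sum[OF assms] clinear_scaleC[OF assms] scaleC_complex_def mult.commute)
    finally show ?thesis by (simp add: op_inner_sum_left op_inner_scaleC_left inner)
  qed
  then show ?thesis by blast
qed

text \<open>For the converse direction an arbitrary functional \<open>\<chi>\<close> is tested on \<open>t\<close>. The functional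
  \<open>\<chi> - \<chi> \<circ> P\<close> vanishes on the range of \<open>P\<close>, so by Riesz it is the inner product with some \<open>S\<close>
  orthogonal to this range; hence \<open>\<chi>\<close> and \<open>\<chi> \<circ> P\<close> have the same slice at \<open>t\<close>.\<close>

lemma tensor_map_fixes_iff_orthogonal:
  assumes "clinear P" and "\<And>T. P (P T) = P T"
  shows "tensor_map P id t = t \<longleftrightarrow> (\<forall>S \<in> op_orthogonal \<psi> (range P). op_inner_leg \<psi> S t = 0)"
proof
  assume fixed: "tensor_map P id t = t"
  show "\<forall>S \<in> op_orthogonal \<psi> (range P). op_inner_leg \<psi> S t = 0"
  proof
    fix S assume "S \<in> op_orthogonal \<psi> (range P)"
    then have "op_inner \<psi> S (P T) = 0" for T
      by (subst op_inner_commute) (simp add: op_orthogonal_def)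
    then have "slice (op_inner \<psi> S) (tensor_map P id t) = slice (\<lambda>_. 0) t"
      by (simp add: slice_tensor_map[OF clinear_op_inner assms(1)])
    also have "\<dots> = 0"
      using slice_scaleC_functional[OF clinear_op_inner, of 0 S t] by simp
    finally show "op_inner_leg \<psi> S t = 0"
      by (simp add: fixed op_inner_leg_def slice_def)
  qed
next
  assume orth: "\<forall>S \<in> op_orthogonal \<psi> (range P). op_inner_leg \<psi> S t = 0"
  show "tensor_map P id t = t"
  proof (rule op_tensor_eqI)
    fix w
    let ?\<chi> = "\<lambda>T. op_pairing \<psi> T \<cdot> w"
    have \<chi>: "clinear ?\<chi>" by (rule clinear_op_pairing)
    then have \<chi>P: "clinear (\<lambda>T. ?\<chi> (P T))"
      by (intro clinearI) (simp_all add: clinear_add[OF assms(1)] clinear_scaleC[OF assms(1)]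
          clinear_add[OF \<chi>] clinear_scaleC[OF \<chi>])
    have "clinear (\<lambda>T. ?\<chi> T - ?\<chi> (P T))"
      by (rule clinearI) (simp_all add: clinear_add[OF \<chi>] clinear_add[OF \<chi>P]
          clinear_scaleC[OF \<chi>] clinear_scaleC[OF \<chi>P] scaleC_complex_def right_diff_distrib)
    then obtain S where S: "(\<lambda>T. ?\<chi> T - ?\<chi> (P T)) = op_inner \<psi> S"
      using op_inner_riesz by blast
    have "op_inner \<psi> S (P T) = 0" for T
      unfolding S[symmetric] by (simp add: assms(2))
    then have "S \<in> op_orthogonal \<psi> (range P)"
      unfolding op_orthogonal_def by (auto simp: op_inner_commute[of _ S])
    then have "slice (op_inner \<psi> S) t = 0"
      using orth by (simp add: op_inner_leg_def slice_def)
    then have "slice ?\<chi> t = slice (\<lambda>T. ?\<chi> (P T)) t"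
      unfolding S[symmetric] slice_diff_functional[OF \<chi> \<chi>P] by simp
    then show "slice ?\<chi> (tensor_map P id t) = slice ?\<chi> t"
      by (simp add: slice_tensor_map[OF \<chi> assms(1)])
  qed
qed

end

section \<open>Pulling operators back along a *-homomorphism\<close>

context parseval_frame
begin

text \<open>Both the adjoint and the involution are conjugate-linear, so that their tensor product is
  well defined.\<close>

lemma op_adjoint_simps:
  fixes \<phi> :: "('c::complex_star_algebra, complex) lmap" and a :: "'a::complex_star_algebra"
    and T :: "('b, 'c) lmap" and t u :: "(('b, 'c) lmap, 'a) tensor"
  assumes "\<And>x. \<phi> \<cdot> star x = cnj (\<phi> \<cdot> x)"
  shows "op_adjoint \<psi> \<phi> (0 :: (('b, 'c) lmap, 'a) tensor) = 0"
    and "op_adjoint \<psi> \<phi> (T \<otimes> a) = adjoint_wrt (L2_inner \<psi>) (L2_inner \<phi>) T \<otimes> star a"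
    and "op_adjoint \<psi> \<phi> (t + u) = op_adjoint \<psi> \<phi> t + op_adjoint \<psi> \<phi> u"
proof -
  have "balanced (\<lambda>T (a::'a). adjoint_wrt (L2_inner \<psi>) (L2_inner \<phi>) T \<otimes> star a)"
    by (simp add: balanced_def adjoint_wrt_conjugate_linear[OF assms] star_add star_scaleC
        tensor_add_left tensor_add_right tensor_scaleC_left tensor_scaleC_right)
  then show "op_adjoint \<psi> \<phi> (0 :: (('b, 'c) lmap, 'a) tensor) = 0"
    and "op_adjoint \<psi> \<phi> (T \<otimes> a) = adjoint_wrt (L2_inner \<psi>) (L2_inner \<phi>) T \<otimes> star a"
    and "op_adjoint \<psi> \<phi> (t + u) = op_adjoint \<psi> \<phi> t + op_adjoint \<psi> \<phi> u"
    by (simp_all add: op_adjoint_def tensor_map_def tensor_lift_zero tensor_lift_elem tensor_lift_add)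
qed

text \<open>On elementary tensors \<open>s = S \<otimes> a\<close>, \<open>t = U \<otimes> b\<close> this is
  \<open>\<psi>(x S\<^sup>\<dagger> T U y) = \<langle>x\<^sup>*|S\<^sup>\<dagger> T U y\<rangle> = \<langle>S x\<^sup>*|T U y\<rangle> = \<phi>((S x\<^sup>*)\<^sup>* T U y)\<close> times \<open>a\<^sup>* b\<close>. The operators \<open>s\<close> and \<open>t\<close>
  are kept apart to allow an induction on each of them.\<close>

lemma slice_adjoint_compose:
  fixes \<phi> :: "('c::complex_star_algebra, complex) lmap"
    and s t :: "(('b, 'c) lmap, 'a::complex_star_algebra) tensor"
  assumes "\<And>x. \<phi> \<cdot> star x = cnj (\<phi> \<cdot> x)"
  shows "slice (\<lambda>T. op_pairing \<psi> T \<cdot> (x \<otimes> y))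
      (op_compose (op_adjoint \<psi> \<phi> s) (op_compose (T \<otimes> 1) t)) =
    slice (lapp (op_pairing \<phi> T)) (tensor_times (\<otimes>) (star (eval_op (star x) s)) (eval_op y t))"
proof -
  note slice_left = slice_simps[OF clinear_op_pairing[of \<psi> "x \<otimes> y"]]
  note slice_right = slice_simps[OF lapp_clinear[of "op_pairing \<phi> T"]]
  have left_elem: "slice (\<lambda>T. op_pairing \<psi> T \<cdot> (x \<otimes> y))
      (op_compose (op_adjoint \<psi> \<phi> (S \<otimes> a)) (op_compose (T \<otimes> 1) t)) =
    slice (lapp (op_pairing \<phi> T))
      (tensor_times (\<otimes>) (star (eval_op (star x) (S \<otimes> a))) (eval_op y t))" for S a
  proof (induction t)
    case zero
    show ?case by (simp only: op_compose_def lcomp.times_simps eval_op_simps elem_tensor.times_simps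
        slice_left(3) slice_right(3))
  next
    case (elem U b)
    have "\<psi> \<cdot> (x * adjoint_wrt (L2_inner \<psi>) (L2_inner \<phi>) S \<cdot> T \<cdot> U \<cdot> y) =
        \<phi> \<cdot> (star (S \<cdot> star x) * T \<cdot> U \<cdot> y)"
    proof -
      have "\<psi> \<cdot> (x * adjoint_wrt (L2_inner \<psi>) (L2_inner \<phi>) S \<cdot> T \<cdot> U \<cdot> y) =
          L2_inner \<psi> (star x) (adjoint_wrt (L2_inner \<psi>) (L2_inner \<phi>) S \<cdot> T \<cdot> U \<cdot> y)"
        by (simp add: L2_inner_def star_star)
      also have "\<dots> = cnj (L2_inner \<phi> (T \<cdot> U \<cdot> y) (S \<cdot> star x))"
        by (subst commute) (simp add: adjoint_wrt_L2_inner[OF assms])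
      also have "\<dots> = L2_inner \<phi> (S \<cdot> star x) (T \<cdot> U \<cdot> y)"
        by (rule L2_inner_commute[OF assms, symmetric])
      finally show ?thesis by (simp add: L2_inner_def)
    qed
    then show ?case
      by (simp add: op_compose_def lcomp.times_simps op_adjoint_simps[OF assms] eval_op_simps
          star_tensor_elem elem_tensor.times_simps slice_left(1) slice_right(1))
        (simp add: op_pairing_elem)
  next
    case (add t u)
    then show ?case by (simp only: op_compose_def lcomp.times_simps eval_op_simps
        elem_tensor.times_simps slice_left(4) slice_right(4))
  qed
  show ?thesis
  proof (induction s)
    case zero
    show ?case by (simp only: op_compose_def lcomp.times_simps eval_op_simps elem_tensor.times_simps
        op_adjoint_simps[OF assms] star_zero slice_left(3) slice_right(3))
  next
    case (elem S a)
    show ?case by (rule left_elem)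
  next
    case (add s s')
    then show ?case by (simp only: op_compose_def lcomp.times_simps eval_op_simps
        elem_tensor.times_simps op_adjoint_simps[OF assms] star_add slice_left(4) slice_right(4))
  qed
qed

text \<open>The map \<open>F\<close> is the transpose of \<open>T \<mapsto> f\<^sup>\<dagger> (T \<otimes> 1) f\<close>: in the preceding lemma \<open>s\<close> and \<open>t\<close> both represent
  \<open>f\<close>, and \<open>f(x\<^sup>*)\<^sup>* = f(x)\<close>.\<close>

lemma slice_pull_op:
  fixes \<phi> :: "('c::complex_star_algebra, complex) lmap"
    and f :: "('b, ('c, 'a::complex_star_algebra) tensor) lmap"
  assumes "finite_dim (UNIV :: 'b set)" and "\<And>x. \<phi> \<cdot> star x = cnj (\<phi> \<cdot> x)"
    and "\<And>x. f \<cdot> star x = star (f \<cdot> x)"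
  shows "slice (\<lambda>T. op_pairing \<psi> T \<cdot> w) (pull_op \<phi> \<psi> f T) =
    slice (lapp (op_pairing \<phi> T)) (F_map f \<cdot> w)"
proof (induction w)
  case zero
  have "slice (\<lambda>_. 0) t = 0" for t :: "(('b, 'b) lmap, 'a) tensor"
    using slice_scaleC_functional[OF clinear_op_pairing[of \<psi> 0], of 0 t] by simp
  then show ?case by (simp add: lapp_zero slice_simps(3)[OF lapp_clinear])
next
  case (elem x y)
  have "eval_op z (op_of f) = f \<cdot> z" for z
    using theI'[OF op_of_ex1[OF assms(1)]] unfolding op_of_def by blast
  then show ?case
    by (simp add: pull_op_def slice_adjoint_compose[OF assms(2)] F_map_elem assms(3) star_star)
next
  case (add v w)
  then show ?case
    by (simp add: lapp_add slice_add_functional[OF clinear_op_pairing clinear_op_pairing]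
        slice_simps(4)[OF lapp_clinear])
qed

end

section \<open>Quantum relations under pull-back\<close>

theorem proposition4p3:
  fixes \<psi>\<^sub>0 :: "('b\<^sub>0::complex_star_algebra, complex) lmap"
    and \<psi>\<^sub>1 :: "('b\<^sub>1::complex_star_algebra, complex) lmap"
    and \<delta>\<^sub>0 \<delta>\<^sub>1 :: real
    and A\<^sub>0 :: "('b\<^sub>0, 'b\<^sub>0) lmap"
    and A\<^sub>1 :: "('b\<^sub>1, 'b\<^sub>1) lmap"
    and t :: algebra_type
    and f :: "('b\<^sub>1, ('b\<^sub>0, 'a::complex_star_algebra) tensor) lmap"
  assumes "quantum_graph \<psi>\<^sub>0 \<delta>\<^sub>0 A\<^sub>0"
    and "quantum_graph \<psi>\<^sub>1 \<delta>\<^sub>1 A\<^sub>1"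
    and "algebra_class t TYPE('a)"
    and "unital_star_hom f"
  shows
    "all_equivalent [
      pull_op \<psi>\<^sub>0 \<psi>\<^sub>1 f ` quantum_relation \<psi>\<^sub>0 \<delta>\<^sub>0 A\<^sub>0 \<subseteq>
        subspace_tensor (quantum_relation \<psi>\<^sub>1 \<delta>\<^sub>1 A\<^sub>1) UNIV,
      \<forall>T. tensor_map (schur \<psi>\<^sub>1 \<delta>\<^sub>1 A\<^sub>1) id (pull_op \<psi>\<^sub>0 \<psi>\<^sub>1 f (schur \<psi>\<^sub>0 \<delta>\<^sub>0 A\<^sub>0 T)) =
        pull_op \<psi>\<^sub>0 \<psi>\<^sub>1 f (schur \<psi>\<^sub>0 \<delta>\<^sub>0 A\<^sub>0 T),
      \<forall>S \<in> op_orthogonal \<psi>\<^sub>1 (quantum_relation \<psi>\<^sub>1 \<delta>\<^sub>1 A\<^sub>1). \<forall>T \<in> quantum_relation \<psi>\<^sub>0 \<delta>\<^sub>0 A\<^sub>0.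
        op_inner_leg \<psi>\<^sub>1 S (pull_op \<psi>\<^sub>0 \<psi>\<^sub>1 f T) = 0,
      (R_map \<psi>\<^sub>0 A\<^sub>0 \<otimes>\<^sub>L lid) \<circ>\<^sub>L F_map f \<circ>\<^sub>L R_map \<psi>\<^sub>1 A\<^sub>1 =
        complex_of_real (\<delta>\<^sub>1\<^sup>2) *\<^sub>C ((R_map \<psi>\<^sub>0 A\<^sub>0 \<otimes>\<^sub>L lid) \<circ>\<^sub>L F_map f)]"
proof -
  have q0: "quantum_set \<psi>\<^sub>0 \<delta>\<^sub>0" and q1: "quantum_set \<psi>\<^sub>1 \<delta>\<^sub>1" and A1: "schur \<psi>\<^sub>1 \<delta>\<^sub>1 A\<^sub>1 A\<^sub>1 = A\<^sub>1"
    using assms(1,2) by (auto simp: quantum_graph_def)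
  obtain E\<^sub>0 E\<^sub>1 where "parseval_frame \<psi>\<^sub>0 E\<^sub>0" "parseval_frame \<psi>\<^sub>1 E\<^sub>1"
    using quantum_set_frame[OF q0] quantum_set_frame[OF q1] by blast
  then interpret p0: parseval_frame \<psi>\<^sub>0 E\<^sub>0 + p1: parseval_frame \<psi>\<^sub>1 E\<^sub>1 .
  have nz: "complex_of_real (\<delta>\<^sub>0\<^sup>2) \<noteq> 0" "complex_of_real (\<delta>\<^sub>1\<^sup>2) \<noteq> 0"
    using quantum_set_delta_nonzero[OF q0] quantum_set_delta_nonzero[OF q1] by simp_all
  define P\<^sub>0 where "P\<^sub>0 = schur \<psi>\<^sub>0 \<delta>\<^sub>0 A\<^sub>0"
  define P\<^sub>1 where "P\<^sub>1 = schur \<psi>\<^sub>1 \<delta>\<^sub>1 A\<^sub>1"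
  define pull where "pull = pull_op \<psi>\<^sub>0 \<psi>\<^sub>1 f"
  define G where "G = (R_map \<psi>\<^sub>0 A\<^sub>0 \<otimes>\<^sub>L lid) \<circ>\<^sub>L F_map f"
  have P1: "clinear P\<^sub>1" "P\<^sub>1 (P\<^sub>1 T) = P\<^sub>1 T" for T
    unfolding P\<^sub>1_def by (rule p1.clinear_schur) (simp only: p1.schur_assoc A1)
  have 12: "pull ` range P\<^sub>0 \<subseteq> subspace_tensor (range P\<^sub>1) UNIV \<longleftrightarrow>
      (\<forall>T. tensor_map P\<^sub>1 id (pull (P\<^sub>0 T)) = pull (P\<^sub>0 T))"
    by (auto simp: tensor_map_fixes_iff_subspace_tensor[OF P1])
  have 32: "(\<forall>S \<in> op_orthogonal \<psi>\<^sub>1 (range P\<^sub>1). \<forall>T \<in> range P\<^sub>0. op_inner_leg \<psi>\<^sub>1 S (pull T) = 0) \<longleftrightarrow>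
      (\<forall>T. tensor_map P\<^sub>1 id (pull (P\<^sub>0 T)) = pull (P\<^sub>0 T))"
    by (auto simp: p1.tensor_map_fixes_iff_orthogonal[OF P1])
  have slice_pull_op': "slice (\<lambda>T. op_pairing \<psi>\<^sub>1 T \<cdot> w) (pull_op \<psi>\<^sub>0 \<psi>\<^sub>1 f T) =
      slice (lapp (op_pairing \<psi>\<^sub>0 T)) (F_map f \<cdot> w)" for T w
    using q1 assms(4) by (intro p1.slice_pull_op p0.hermitian)
      (auto simp: quantum_set_def unital_star_hom_def)
  \<comment> \<open>The transpose of \<open>pull \<circ> P\<^sub>0\<close> is \<open>(R \<otimes> id) \<circ> F\<close> up to \<open>\<delta>\<^sub>0\<^sup>2\<close>.\<close>
  have slice_G: "slice (lapp (op_pairing \<psi>\<^sub>0 T)) (G \<cdot> w) =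
      complex_of_real (\<delta>\<^sub>0\<^sup>2) *\<^sub>C slice (\<lambda>T. op_pairing \<psi>\<^sub>1 T \<cdot> w) (pull (P\<^sub>0 T))" for T w
  proof -
    have "slice (lapp (op_pairing \<psi>\<^sub>0 T)) (G \<cdot> w) =
        slice (\<lambda>u. op_pairing \<psi>\<^sub>0 T \<cdot> R_map \<psi>\<^sub>0 A\<^sub>0 \<cdot> u) (F_map f \<cdot> w)"
      unfolding G_def by (simp add: slice_ltensor_lid[OF lapp_clinear])
    also have "\<dots> = complex_of_real (\<delta>\<^sub>0\<^sup>2) *\<^sub>C slice (lapp (op_pairing \<psi>\<^sub>0 (P\<^sub>0 T))) (F_map f \<cdot> w)"
      using nz(1) by (simp add: op_pairing_R_map P\<^sub>0_def slice_scaleC_functional[OF lapp_clinear])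
    finally show ?thesis
      using slice_pull_op' by (simp add: pull_def)
  qed
  have 24: "(\<forall>T. tensor_map P\<^sub>1 id (pull (P\<^sub>0 T)) = pull (P\<^sub>0 T)) \<longleftrightarrow>
      G \<circ>\<^sub>L R_map \<psi>\<^sub>1 A\<^sub>1 = complex_of_real (\<delta>\<^sub>1\<^sup>2) *\<^sub>C G"
  proof -
    have "(\<forall>T. tensor_map P\<^sub>1 id (pull (P\<^sub>0 T)) = pull (P\<^sub>0 T)) \<longleftrightarrow>
      (\<forall>T w. complex_of_real (\<delta>\<^sub>1\<^sup>2) *\<^sub>C slice (\<lambda>T. op_pairing \<psi>\<^sub>1 T \<cdot> w) (tensor_map P\<^sub>1 id (pull (P\<^sub>0 T))) =
        complex_of_real (\<delta>\<^sub>1\<^sup>2) *\<^sub>C slice (\<lambda>T. op_pairing \<psi>\<^sub>1 T \<cdot> w) (pull (P\<^sub>0 T)))"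
      using nz(2) p1.op_tensor_eqI by (auto simp: complex_vector.scale_cancel_left)
    also have "\<dots> \<longleftrightarrow> (\<forall>T w. slice (\<lambda>T. op_pairing \<psi>\<^sub>1 T \<cdot> R_map \<psi>\<^sub>1 A\<^sub>1 \<cdot> w) (pull (P\<^sub>0 T)) =
        complex_of_real (\<delta>\<^sub>1\<^sup>2) *\<^sub>C slice (\<lambda>T. op_pairing \<psi>\<^sub>1 T \<cdot> w) (pull (P\<^sub>0 T)))"
      unfolding P\<^sub>1_def p1.slice_schur[OF quantum_set_delta_nonzero[OF q1]] ..
    also have "\<dots> \<longleftrightarrow> (\<forall>T w. slice (lapp (op_pairing \<psi>\<^sub>0 T)) (G \<cdot> R_map \<psi>\<^sub>1 A\<^sub>1 \<cdot> w) =
        complex_of_real (\<delta>\<^sub>1\<^sup>2) *\<^sub>C slice (lapp (op_pairing \<psi>\<^sub>0 T)) (G \<cdot> w))"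
      unfolding slice_G complex_vector.scale_left_commute[of _ "complex_of_real (\<delta>\<^sub>0\<^sup>2)"]
      using nz(1) by (simp only: complex_vector.scale_cancel_left simp_thms)
    also have "\<dots> \<longleftrightarrow> (\<forall>w. G \<cdot> R_map \<psi>\<^sub>1 A\<^sub>1 \<cdot> w = complex_of_real (\<delta>\<^sub>1\<^sup>2) *\<^sub>C G \<cdot> w)"
      unfolding clinear_scaleC[OF slice_simps(2)[OF lapp_clinear], symmetric]
      using p0.pairing_tensor_eqI by metis
    finally show ?thesis by (simp add: lmap_eq_iff)
  qed
  show ?thesis
    unfolding all_equivalent_def quantum_relation_def
    using 12 32 24 unfolding P\<^sub>0_def P\<^sub>1_def pull_def G_def by auto
qed

end
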